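(* For every $\varepsilon>0$ there exists $K>0$ such that $$\left|\frac{N_{n,4t}}{A_{n,4t}}-1\right|<\varepsilon\qquad\text{for all integers } n\ge 2 \text{ and } t\ge Kn^3.$$
   Context: An $n\times s$ matrix with entries in $\{\pm1\}$ is a partial Hadamard matrix if its rows are pairwise orthogonal. $N_{n,s}$ denotes the number of $n\times s$ partial Hadamard matrices. With $d=\binom{n}{2}$, set $A_{n,s}:=2^{ns+2d-n+1}(2\pi s)^{-d/2}$. *)

theory Defs
  imports Complex_Main "HOL-Library.FuncSet" "Jordan_Normal_Form.Matrix"
begin

definition partial_hadamard :: "nat \<Rightarrow> nat \<Rightarrow> int mat \<Rightarrow> bool" where
  "partial_hadamard n s M \<longleftrightarrow>
     M \<in> carrier_mat n s \<and>
     (\<forall>i<n. \<forall>j<s. M $$ (i, j) \<in> {1, -1}) \<and>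
     (\<forall>i<n. \<forall>j<n. i \<noteq> j \<longrightarrow> scalar_prod (row M i) (row M j) = 0)"

(* Needed so that the cardinality in num_partial_hadamard is not the default value 0. *)
lemma finite_partial_hadamard: "finite {M. partial_hadamard n s M}"
proof (rule finite_subset)
  show "{M. partial_hadamard n s M} \<subseteq> mat n s ` (({..<n} \<times> {..<s}) \<rightarrow>\<^sub>E {1, -1})"
  proof
    fix M assume "M \<in> {M. partial_hadamard n s M}"
    then have M: "M \<in> carrier_mat n s" "\<forall>i<n. \<forall>j<s. M $$ (i, j) \<in> {1, -1}"
      by (auto simp: partial_hadamard_def)
    let ?f = "restrict (\<lambda>p. M $$ p) ({..<n} \<times> {..<s})"
    have "M = mat n s ?f" using M(1) by (intro eq_matI) auto
    moreover have "?f \<in> ({..<n} \<times> {..<s}) \<rightarrow>\<^sub>E {1, -1}" using M(2) by auto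
    ultimately show "M \<in> mat n s ` (({..<n} \<times> {..<s}) \<rightarrow>\<^sub>E {1, -1})" by blast
  qed
  show "finite (mat n s ` (({..<n} \<times> {..<s}) \<rightarrow>\<^sub>E {1, -1 :: int}))"
    by (intro finite_imageI finite_PiE) auto
qed

definition num_partial_hadamard :: "nat \<Rightarrow> nat \<Rightarrow> nat" where
  "num_partial_hadamard n s = card {M. partial_hadamard n s M}"

(* The exponents are real, which avoids truncated subtraction. *)
definition hadamard_asymp :: "nat \<Rightarrow> nat \<Rightarrow> real" where
  "hadamard_asymp n s =
     (let d = real (n choose 2)
      in 2 powr (real n * real s + 2 * d - real n + 1) * (2 * pi * real s) powr (- d / 2))"

end

theory Submission
  imports Defs "HOL-Probability.Probability"
begin

text \<open>
  The matrices are built row by row. Write \<open>s = 4t\<close> and let \<open>p\<^sub>k\<close> be the probability that a uniformly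
  random \<open>k \<times> s\<close> sign matrix is a partial Hadamard matrix. Appending a sign vector \<open>x\<close> to a partial
  Hadamard matrix \<open>H\<close> with \<open>k\<close> rows gives another one exactly if \<open>H x = 0\<close>, so \<open>p\<^bsub>k+1\<^esub>\<close> is \<open>p\<^sub>k\<close> times
  an average, over the partial Hadamard matrices \<open>H\<close>, of the probability that \<open>H x = 0\<close>. The claim is
  that this average is \<open>q\<^sub>k (1 + O(k\<^sup>2 / s))\<close> with \<open>q\<^sub>k = (4 / sqrt (2 \<pi> s))\<^sup>k / 2\<close>. The product of
  the \<open>q\<^sub>i\<close>, times the number \<open>2^(n s)\<close> of all sign matrices, is \<open>A\<^bsub>n,s\<^esub>\<close>, and the relative errors
  \<open>O(k\<^sup>2 / s)\<close> for \<open>k < n\<close> add up to \<open>O(n\<^sup>3 / s)\<close>, whence the threshold \<open>t \<ge> K n\<^sup>3\<close>. Working with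
  one row at a time keeps the integrals \<open>k\<close>-dimensional instead of \<open>k\<^sup>2\<close>-dimensional.

  Let \<open>h\<^sub>1, \<dots>, h\<^sub>s\<close> be the columns of \<open>H\<close>. Orthogonality of the rows forces the entries of
  \<open>H x\<close> to be even and congruent to each other modulo 4, which lets Fourier inversion run over the
  small cube \<open>[-\<pi>/4, \<pi>/4]\<^sup>k\<close>: the probability that \<open>H x = 0\<close> is, up to the factor \<open>(2/\<pi>)\<^sup>k / 2\<close>, the
  integral of \<open>\<Prod>\<^sub>j cos \<langle>\<theta>, h\<^sub>j\<rangle>\<close> plus a term of absolute value \<open>\<Prod>\<^sub>j |sin \<langle>\<theta>, h\<^sub>j\<rangle>|\<close>
  (\<open>card_orth_signs_integral\<close>).

  Near the origin, \<open>\<Sum>\<^sub>j \<langle>\<theta>, h\<^sub>j\<rangle>\<^sup>2 = s |\<theta>|\<^sup>2\<close> holds exactly, again by orthogonality. So for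
  \<open>|\<theta>|\<^sup>2 \<le> 1/k\<close>, where all \<open>|\<langle>\<theta>, h\<^sub>j\<rangle>| \<le> 1\<close>, the cosine product is \<open>exp (- s |\<theta>|\<^sup>2 / 2)\<close> up to a
  relative error \<open>\<Sum>\<^sub>j \<langle>\<theta>, h\<^sub>j\<rangle>\<^sup>4\<close> (\<open>cos_prod_core\<close>), whose Gaussian average is \<open>O(k\<^sup>2 / s)\<close>
  (\<open>gaussian_fourth_moment\<close>).

  Away from the origin no single \<open>H\<close> can be controlled: there are degenerate partial Hadamard matrices.
  But only the sum over \<open>H\<close> matters, and for each fixed \<open>\<theta>\<close> the columns of a random sign matrix are
  independent. For \<open>|\<theta>|\<^sup>2 < 1/4\<close> a lower-tail Chernoff bound for \<open>\<Sum>\<^sub>j sin\<^sup>2 \<langle>\<theta>, h\<^sub>j\<rangle>\<close> shows that all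
  but a fraction \<open>exp (- s / 24)\<close> of all sign matrices have a cosine product of absolute value at most
  \<open>exp (- s |\<theta>|\<^sup>2 / 8)\<close>; for larger \<open>\<theta>\<close> in the cube the average of this absolute value over all sign matrices
  is itself at most \<open>exp (- s / 24)\<close> (\<open>sum_hadamards_cos_le\<close>). These exceptional contributions are
  measured relative to all sign matrices rather than to the partial Hadamard matrices; this is harmless because \<open>p\<^sub>k\<close> is at least about \<open>s\<close> to the power
  \<open>- k\<^sup>2 / 4\<close>, and \<open>k\<^sup>2 log s\<close> is small against \<open>s\<close> when \<open>s \<ge> K k\<^sup>3\<close> (\<open>exceptional_term_small\<close>).
\<close>

section \<open>Sign vectors and matrices as families of columns\<close>

definition signs :: "nat \<Rightarrow> (nat \<Rightarrow> real) set" where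
  "signs k = {..<k} \<rightarrow>\<^sub>E {1, -1}"

text \<open>
  A \<open>k \<times> s\<close> sign matrix is stored by columns, \<open>H j i\<close> being the entry in row \<open>i\<close> and column \<open>j\<close>, so that
  sums over all matrices of products over columns factor.
\<close>

definition sign_matrices :: "nat \<Rightarrow> nat \<Rightarrow> (nat \<Rightarrow> nat \<Rightarrow> real) set" where
  "sign_matrices k s = {..<s} \<rightarrow>\<^sub>E signs k"

definition hadamards :: "nat \<Rightarrow> nat \<Rightarrow> (nat \<Rightarrow> nat \<Rightarrow> real) set" where
  "hadamards k s = {H \<in> sign_matrices k s. \<forall>i<k. \<forall>l<k. i \<noteq> l \<longrightarrow> (\<Sum>j<s. H j i * H j l) = 0}"

definition dot :: "nat \<Rightarrow> (nat \<Rightarrow> real) \<Rightarrow> (nat \<Rightarrow> real) \<Rightarrow> real" where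
  "dot k \<theta> h = (\<Sum>i<k. \<theta> i * h i)"

definition sqnorm :: "nat \<Rightarrow> (nat \<Rightarrow> real) \<Rightarrow> real" where
  "sqnorm k \<theta> = (\<Sum>i<k. (\<theta> i)\<^sup>2)"

lemma finite_signs [simp]: "finite (signs k)"
  by (auto simp: signs_def intro!: finite_PiE)

lemma finite_sign_matrices [simp]: "finite (sign_matrices k s)"
  by (auto simp: sign_matrices_def intro!: finite_PiE)

lemma finite_hadamards [simp]: "finite (hadamards k s)"
  by (simp add: hadamards_def)

lemma card_signs: "card (signs k) = 2 ^ k"
  by (simp add: signs_def card_PiE numeral_2_eq_2)

lemma card_sign_matrices: "card (sign_matrices k s) = 2 ^ (k * s)"
  by (simp add: sign_matrices_def card_PiE card_signs power_mult)

lemma signs_cases: "h \<in> signs k \<Longrightarrow> i < k \<Longrightarrow> h i = 1 \<or> h i = -1"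
  by (auto simp: signs_def PiE_iff)

lemma signs_square: "h \<in> signs k \<Longrightarrow> i < k \<Longrightarrow> h i * h i = 1"
  using signs_cases[of h k i] by auto

lemma sign_matrices_nth: "H \<in> sign_matrices k s \<Longrightarrow> j < s \<Longrightarrow> H j \<in> signs k"
  by (auto simp: sign_matrices_def PiE_iff)

lemma hadamards_sign_matrices: "H \<in> hadamards k s \<Longrightarrow> H \<in> sign_matrices k s"
  by (simp add: hadamards_def)

section \<open>Moments of random signed sums\<close>

lemma sum_signs_Suc:
  fixes F :: "(nat \<Rightarrow> real) \<Rightarrow> 'a::comm_monoid_add"
  shows "(\<Sum>h\<in>signs (Suc k). F h) = (\<Sum>h\<in>signs k. F (h(k := 1)) + F (h(k := -1)))"
proof -
  have "(\<Sum>h\<in>signs (Suc k). F h) = (\<Sum>(y, h)\<in>{1, -1} \<times> signs k. F (h(k := y)))"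
    unfolding signs_def lessThan_Suc
    by (intro sum.reindex_bij_witness[of _ "\<lambda>(y,g). g(k := y)" "\<lambda>g. (g k, g(k := undefined))"])
       (auto simp: PiE_def extensional_def split: if_splits)
  also have "\<dots> = (\<Sum>y\<in>{1, -1}. \<Sum>h\<in>signs k. F (h(k := y)))"
    by (subst sum.cartesian_product) auto
  finally show ?thesis by (simp add: sum.distrib)
qed

lemma dot_Suc_upd [simp]: "dot (Suc k) \<theta> (h(k := y)) = dot k \<theta> h + \<theta> k * y"
  by (simp add: dot_def)

lemma sum_signs_square: "(\<Sum>h\<in>signs k. (dot k \<theta> h)\<^sup>2) = 2 ^ k * sqnorm k \<theta>"
proof (induction k)
  case 0
  show ?case by (simp add: dot_def sqnorm_def)
next
  case (Suc k)
  have "(\<Sum>h\<in>signs (Suc k). (dot (Suc k) \<theta> h)\<^sup>2)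
      = (\<Sum>h\<in>signs k. 2 * (dot k \<theta> h)\<^sup>2 + 2 * (\<theta> k)\<^sup>2)"
    unfolding sum_signs_Suc by (intro sum.cong) (auto simp: power2_eq_square algebra_simps)
  also have "\<dots> = 2 * (2 ^ k * sqnorm k \<theta>) + 2 ^ k * (2 * (\<theta> k)\<^sup>2)"
    by (simp add: sum.distrib sum_distrib_left[symmetric] Suc card_signs)
  finally show ?case by (simp add: sqnorm_def algebra_simps)
qed

text \<open>
  Khinchine's inequality for the fourth moment. In the induction the only loss is in the pure fourth power
  of the new coordinate, which has coefficient 2 where the square of the bound provides 6.
\<close>

lemma sum_signs_fourth: "(\<Sum>h\<in>signs k. (dot k \<theta> h) ^ 4) \<le> 2 ^ k * (3 * (sqnorm k \<theta>)\<^sup>2)"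
proof (induction k)
  case 0
  show ?case by (simp add: dot_def sqnorm_def)
next
  case (Suc k)
  have "(\<Sum>h\<in>signs (Suc k). (dot (Suc k) \<theta> h) ^ 4)
      = (\<Sum>h\<in>signs k. 2 * (dot k \<theta> h) ^ 4 + 12 * (\<theta> k)\<^sup>2 * (dot k \<theta> h)\<^sup>2 + 2 * (\<theta> k) ^ 4)"
    unfolding sum_signs_Suc
    by (intro sum.cong) (auto simp: power2_eq_square power4_eq_xxxx algebra_simps)
  also have "\<dots> = 2 * (\<Sum>h\<in>signs k. (dot k \<theta> h) ^ 4)
      + 12 * (\<theta> k)\<^sup>2 * (2 ^ k * sqnorm k \<theta>) + 2 ^ k * (2 * (\<theta> k) ^ 4)"
    by (simp add: sum.distrib sum_distrib_left[symmetric] sum_signs_square card_signs)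
  also have "\<dots> \<le> 2 * (2 ^ k * (3 * (sqnorm k \<theta>)\<^sup>2))
      + 12 * (\<theta> k)\<^sup>2 * (2 ^ k * sqnorm k \<theta>) + 2 ^ k * (6 * (\<theta> k) ^ 4)"
    using Suc by (intro add_mono mult_left_mono) auto
  also have "\<dots> = 2 ^ Suc k * (3 * (sqnorm (Suc k) \<theta>)\<^sup>2)"
    by (simp add: sqnorm_def power2_eq_square power4_eq_xxxx algebra_simps)
  finally show ?case .
qed

lemma sum_signs_cos: "(\<Sum>h\<in>signs k. cos (dot k v h)) = 2 ^ k * (\<Prod>i<k. cos (v i))"
proof (induction k)
  case 0
  show ?case by (simp add: dot_def signs_def)
next
  case (Suc k)
  have "(\<Sum>h\<in>signs (Suc k). cos (dot (Suc k) v h)) = (\<Sum>h\<in>signs k. 2 * cos (v k) * cos (dot k v h))"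
    unfolding sum_signs_Suc by (intro sum.cong) (auto simp: cos_add cos_diff)
  also have "\<dots> = 2 * cos (v k) * (2 ^ k * (\<Prod>i<k. cos (v i)))"
    by (simp add: sum_distrib_left[symmetric] Suc)
  finally show ?case by simp
qed

lemma sum_sign_matrices_prod:
  fixes f :: "(nat \<Rightarrow> real) \<Rightarrow> real"
  shows "(\<Sum>H\<in>sign_matrices k s. \<Prod>j<s. f (H j)) = (\<Sum>h\<in>signs k. f h) ^ s"
  unfolding sign_matrices_def by (subst prod_sum_PiE[symmetric]) auto

lemma sum_signs_cis: "(\<Sum>x\<in>signs s. cis (\<Sum>j<s. x j * u j)) = of_real (\<Prod>j<s. 2 * cos (u j))"
proof -
  have "(\<Sum>x\<in>signs s. cis (\<Sum>j<s. x j * u j)) = (\<Sum>x\<in>signs s. \<Prod>j<s. cis (x j * u j))"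
    by (simp add: cis_conv_exp exp_sum sum_distrib_left)
  also have "\<dots> = (\<Prod>j<s. \<Sum>y\<in>{1,-1}. cis (y * u j))"
    unfolding signs_def by (subst prod_sum_PiE) auto
  also have "\<dots> = (\<Prod>j<s. of_real (2 * cos (u j)))"
    by (intro prod.cong) (auto simp: complex_eq_iff)
  finally show ?thesis by simp
qed

section \<open>Partial Hadamard matrices and row extension\<close>

text \<open>
  The passage from integer matrices to real column families: casting the entries is inverted by taking floors.
\<close>

lemma num_partial_hadamard_eq: "num_partial_hadamard k s = card (hadamards k s)"
proof -
  let ?f = "\<lambda>M::int mat. \<lambda>j\<in>{..<s}. \<lambda>i\<in>{..<k}. real_of_int (M $$ (i, j))"
  let ?g = "\<lambda>H. Matrix.mat k s (\<lambda>(i, j). \<lfloor>H j i\<rfloor>) :: int mat"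
  have sp: "scalar_prod (Matrix.row M i) (Matrix.row M l) = (\<Sum>j<s. M $$ (i, j) * M $$ (l, j))"
    if "M \<in> carrier_mat k s" "i < k" "l < k" for M :: "int mat" and i l
    using that by (auto simp: scalar_prod_def lessThan_atLeast0 intro!: sum.cong)
  have "bij_betw ?f {M. partial_hadamard k s M} (hadamards k s)"
  proof (rule bij_betw_byWitness[where f' = ?g])
    show "\<forall>M\<in>{M. partial_hadamard k s M}. ?g (?f M) = M"
      by (auto simp: partial_hadamard_def intro!: eq_matI)
    show "\<forall>H\<in>hadamards k s. ?f (?g H) = H"
    proof
      fix H assume H: "H \<in> hadamards k s"
      then have HC: "H \<in> {..<s} \<rightarrow>\<^sub>E signs k" by (simp add: hadamards_def sign_matrices_def)
      have "?f (?g H) j = H j" for j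
      proof (cases "j < s")
        case True
        then have h: "H j \<in> signs k" by (intro PiE_mem[OF HC]) simp
        have "real_of_int \<lfloor>H j i\<rfloor> = H j i" if "i < k" for i
          using signs_cases[OF h that] by (elim disjE) simp_all
        moreover have "H j i = undefined" if "\<not> i < k" for i
          using h unfolding signs_def by (rule PiE_arb) (use that in simp)
        ultimately show ?thesis using True by (simp add: fun_eq_iff)
      next
        case False
        have "H j = undefined" using HC by (rule PiE_arb) (use False in simp)
        then show ?thesis using False by simp
      qed
      then show "?f (?g H) = H" by (rule ext)
    qed
    show "?f ` {M. partial_hadamard k s M} \<subseteq> hadamards k s"
    proof safe
      fix M assume M: "partial_hadamard k s M"
      then have c: "M \<in> carrier_mat k s" by (simp add: partial_hadamard_def)
      have "?f M \<in> sign_matrices k s"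
      proof -
        have "real_of_int (M $$ (i, j)) \<in> {1, -1}" if "i < k" "j < s" for i j
        proof -
          have "M $$ (i, j) = 1 \<or> M $$ (i, j) = -1"
            using M that by (auto simp: partial_hadamard_def)
          then show ?thesis by (elim disjE) simp_all
        qed
        then show ?thesis
          unfolding sign_matrices_def signs_def restrict_PiE_iff by (auto simp: restrict_PiE_iff)
      qed
      moreover have "(\<Sum>j<s. ?f M j i * ?f M j l) = 0" if "i < k" "l < k" "i \<noteq> l" for i l
      proof -
        have "(\<Sum>j<s. ?f M j i * ?f M j l) = real_of_int (\<Sum>j<s. M $$ (i, j) * M $$ (l, j))"
          using that by simp
        also have "\<dots> = 0" using M that by (simp add: partial_hadamard_def sp[OF c, symmetric])
        finally show ?thesis .
      qed
      ultimately show "?f M \<in> hadamards k s" by (simp add: hadamards_def)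
    qed
    show "?g ` hadamards k s \<subseteq> {M. partial_hadamard k s M}"
    proof safe
      fix H assume H: "H \<in> hadamards k s"
      have fl: "H j i = 1 \<or> H j i = -1" if "i < k" "j < s" for i j
        by (rule signs_cases[OF sign_matrices_nth[OF hadamards_sign_matrices[OF H]] that(1)]) (rule that)
      have fl': "real_of_int \<lfloor>H j i\<rfloor> = H j i" if "i < k" "j < s" for i j
        using fl[OF that] by (elim disjE) simp_all
      have c: "?g H \<in> carrier_mat k s" by simp
      have "(\<Sum>j<s. \<lfloor>H j i\<rfloor> * \<lfloor>H j l\<rfloor>) = 0" if "i < k" "l < k" "i \<noteq> l" for i l
      proof -
        have "real_of_int (\<Sum>j<s. \<lfloor>H j i\<rfloor> * \<lfloor>H j l\<rfloor>) = (\<Sum>j<s. H j i * H j l)"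
          using that by (simp add: fl')
        also have "\<dots> = 0" using H that by (simp add: hadamards_def)
        finally show ?thesis by linarith
      qed
      then have "scalar_prod (Matrix.row (?g H) i) (Matrix.row (?g H) l) = 0"
        if "i < k" "l < k" "i \<noteq> l" for i l
        using that by (subst sp[OF c]) auto
      moreover have "?g H $$ (i, j) \<in> {1, -1}" if "i < k" "j < s" for i j
      proof -
        have "real_of_int \<lfloor>H j i\<rfloor> = 1 \<or> real_of_int \<lfloor>H j i\<rfloor> = -1"
          using fl[OF that] by (simp only: fl'[OF that])
        then have "\<lfloor>H j i\<rfloor> = 1 \<or> \<lfloor>H j i\<rfloor> = -1" by linarith
        then show ?thesis using that by simp
      qed
      ultimately show "partial_hadamard k s (?g H)"
        unfolding partial_hadamard_def using c by blast
    qed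
  qed
  then show ?thesis unfolding num_partial_hadamard_def by (rule bij_betw_same_card)
qed

definition orth_signs :: "nat \<Rightarrow> nat \<Rightarrow> (nat \<Rightarrow> nat \<Rightarrow> real) \<Rightarrow> (nat \<Rightarrow> real) set" where
  "orth_signs k s H = {x \<in> signs s. \<forall>i<k. (\<Sum>j<s. x j * H j i) = 0}"

lemma card_hadamards_Suc:
  "card (hadamards (Suc k) s) = (\<Sum>H\<in>hadamards k s. card (orth_signs k s H))"
proof -
  let ?S = "SIGMA H:hadamards k s. orth_signs k s H"
  let ?f = "\<lambda>(H, x). \<lambda>j\<in>{..<s}. (H j)(k := x j)"
  \<comment> \<open>Columns are extensional functions, so deleting the last row has to make its entries undefined.\<close>
  let ?g = "\<lambda>H. (\<lambda>j\<in>{..<s}. (H j)(k := undefined), \<lambda>j\<in>{..<s}. H j k)"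
  have "bij_betw ?f ?S (hadamards (Suc k) s)"
  proof (rule bij_betw_byWitness[where f' = ?g])
    show "\<forall>p\<in>?S. ?g (?f p) = p"
    proof
      fix p assume "p \<in> ?S"
      then obtain H x where p: "p = (H, x)"
        and H: "H \<in> hadamards k s" and x: "x \<in> orth_signs k s H" by blast
      have u: "H j k = undefined" if "j < s" for j
      proof -
        have "H j \<in> signs k" by (rule sign_matrices_nth[OF hadamards_sign_matrices[OF H] that])
        then show ?thesis unfolding signs_def by (rule PiE_arb) simp
      qed
      have e: "H j = undefined" "x j = undefined" if "\<not> j < s" for j
      proof -
        have "H \<in> {..<s} \<rightarrow>\<^sub>E signs k" using H by (simp add: hadamards_def sign_matrices_def)
        then show "H j = undefined" by (rule PiE_arb) (use that in simp)
        have "x \<in> {..<s} \<rightarrow>\<^sub>E {1, -1}" using x by (simp add: orth_signs_def signs_def)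
        then show "x j = undefined" by (rule PiE_arb) (use that in simp)
      qed
      show "?g (?f p) = p"
      proof -
        have 1: "(\<lambda>j\<in>{..<s}. ((\<lambda>j\<in>{..<s}. (H j)(k := x j)) j)(k := undefined)) = H"
        proof (rule ext)
          fix j show "(\<lambda>j\<in>{..<s}. ((\<lambda>j\<in>{..<s}. (H j)(k := x j)) j)(k := undefined)) j = H j"
            using u[of j] e(1)[of j] by (cases "j < s") (simp_all add: fun_upd_idem)
        qed
        have 2: "(\<lambda>j\<in>{..<s}. (\<lambda>j\<in>{..<s}. (H j)(k := x j)) j k) = x"
        proof (rule ext)
          fix j show "(\<lambda>j\<in>{..<s}. (\<lambda>j\<in>{..<s}. (H j)(k := x j)) j k) j = x j"
            using e(2)[of j] by (cases "j < s") simp_all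
        qed
        show ?thesis unfolding p prod.case using 1 2 by (rule arg_cong2[of _ _ _ _ Pair])
      qed
    qed
    show "\<forall>H\<in>hadamards (Suc k) s. ?f (?g H) = H"
    proof
      fix H assume "H \<in> hadamards (Suc k) s"
      then have "H \<in> {..<s} \<rightarrow>\<^sub>E signs (Suc k)" by (simp add: hadamards_def sign_matrices_def)
      then have e: "H j = undefined" if "\<not> j < s" for j
        by (rule PiE_arb) (use that in simp)
      show "?f (?g H) = H"
      proof (rule ext)
        fix j show "?f (?g H) j = H j" using e[of j] by (cases "j < s") simp_all
      qed
    qed
    show "?f ` ?S \<subseteq> hadamards (Suc k) s"
    proof safe
      fix H x assume H: "H \<in> hadamards k s" and x: "x \<in> orth_signs k s H"
      have "(\<lambda>j\<in>{..<s}. (H j)(k := x j)) \<in> sign_matrices (Suc k) s"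
        using H x
        by (auto simp: hadamards_def sign_matrices_def orth_signs_def signs_def PiE_def Pi_def
            extensional_def less_Suc_eq)
      then show "(\<lambda>j\<in>{..<s}. (H j)(k := x j)) \<in> hadamards (Suc k) s"
        using H x by (auto simp: hadamards_def orth_signs_def less_Suc_eq mult.commute)
    qed
    show "?g ` hadamards (Suc k) s \<subseteq> ?S"
    proof (rule image_subsetI)
      fix H assume H: "H \<in> hadamards (Suc k) s"
      then have H': "H \<in> sign_matrices (Suc k) s"
        and o: "\<And>i l. i < Suc k \<Longrightarrow> l < Suc k \<Longrightarrow> i \<noteq> l \<Longrightarrow> (\<Sum>j<s. H j i * H j l) = 0"
        by (auto simp: hadamards_def)
      have "(\<lambda>j\<in>{..<s}. (H j)(k := undefined)) \<in> sign_matrices k s"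
        using H' by (auto simp: sign_matrices_def signs_def PiE_def Pi_def extensional_def)
      then have 1: "(\<lambda>j\<in>{..<s}. (H j)(k := undefined)) \<in> hadamards k s"
        using o by (auto simp: hadamards_def)
      have "(\<lambda>j\<in>{..<s}. H j k) \<in> signs s"
        using H' by (auto simp: sign_matrices_def signs_def PiE_def Pi_def extensional_def)
      then have "(\<lambda>j\<in>{..<s}. H j k) \<in> orth_signs k s (\<lambda>j\<in>{..<s}. (H j)(k := undefined))"
        using o[of k] by (auto simp: orth_signs_def)
      with 1 show "?g H \<in> ?S" by blast
    qed
  qed
  then have "card (hadamards (Suc k) s) = card ?S" by (rule bij_betw_same_card[symmetric])
  also have "\<dots> = (\<Sum>H\<in>hadamards k s. card (orth_signs k s H))"
    by (subst card_SigmaI) (auto simp: orth_signs_def)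
  finally show ?thesis .
qed

lemma card_hadamards_1: "card (hadamards 1 s) = 2 ^ s"
proof -
  have "hadamards 1 s = sign_matrices 1 s" by (auto simp: hadamards_def)
  then show ?thesis by (simp add: card_sign_matrices)
qed

section \<open>Elementary inequalities for sine, cosine and the exponential function\<close>

lemma lessThan_four: "{..<4::nat} = {0, 1, 2, 3}" and lessThan_three: "{..<3::nat} = {0, 1, 2}"
  by auto

lemma cos_le_quartic: "cos (u::real) \<le> 1 - u\<^sup>2 / 2 + u ^ 4 / 24"
proof -
  obtain t where t: "cos u = (\<Sum>m<4. cos_coeff m * u ^ m) + (cos (t + 1/2 * real 4 * pi) / fact 4) * u ^ 4"
    using Maclaurin_cos_expansion[of u 4] by blast
  have "(cos (t + 1/2 * real 4 * pi) / fact 4) * u ^ 4 \<le> (1 / fact 4) * u ^ 4"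
    by (intro mult_right_mono divide_right_mono) auto
  then show ?thesis
    unfolding t by (simp add: lessThan_four cos_coeff_def fact_numeral)
qed

lemma cos_ge_quadratic: "cos (u::real) \<ge> 1 - u\<^sup>2 / 2"
proof -
  have "cos u = 1 - 2 * (sin (u / 2))\<^sup>2" using cos_double_sin[of "u / 2"] by simp
  moreover have "(sin (u / 2))\<^sup>2 \<le> (u / 2)\<^sup>2"
    using abs_sin_x_le_abs_x[of "u / 2"] by (simp only: abs_le_square_iff)
  ultimately show ?thesis by (simp add: power_divide)
qed

lemma exp_ge_cubic: "exp (- v :: real) \<ge> 1 - v + v\<^sup>2 / 2 - v ^ 3 / 6"
proof -
  obtain t where t: "exp (- v) = (\<Sum>m<4. (- v) ^ m / fact m) + (exp t / fact 4) * (- v) ^ 4"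
    using Maclaurin_exp_le[of "- v" 4] by blast
  have "0 \<le> (exp t / fact 4) * (- v) ^ 4" by simp
  then show ?thesis
    unfolding t by (simp add: lessThan_four fact_numeral)
qed

lemma exp_neg_le_quadratic:
  assumes "(x::real) \<ge> 0"
  shows "exp (- x) \<le> 1 - x + x\<^sup>2 / 2"
proof -
  obtain t where t: "exp (- x) = (\<Sum>m<3. (- x) ^ m / fact m) + (exp t / fact 3) * (- x) ^ 3"
    using Maclaurin_exp_le[of "- x" 3] by blast
  have "(exp t / fact 3) * (- x) ^ 3 \<le> 0" using assms
    by (intro mult_nonneg_nonpos) (auto simp: power3_eq_cube mult_nonneg_nonneg)
  then show ?thesis
    unfolding t by (simp add: lessThan_three fact_numeral)
qed

lemma cos_le_exp:
  assumes "\<bar>u::real\<bar> \<le> 2"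
  shows "cos u \<le> exp (- u\<^sup>2 / 2)"
proof -
  have u: "u\<^sup>2 \<le> 4" using assms abs_le_square_iff[of u 2] by simp
  have "u ^ 4 * (4 - u\<^sup>2) \<ge> 0" using u by simp
  then have "u ^ 6 \<le> 4 * u ^ 4" by (simp add: algebra_simps flip: power_add)
  moreover have "(u\<^sup>2 / 2)\<^sup>2 = u ^ 4 / 4" "(u\<^sup>2 / 2) ^ 3 = u ^ 6 / 8"
    by (simp_all add: power_divide flip: power_mult)
  ultimately have "1 - u\<^sup>2 / 2 + u ^ 4 / 24 \<le> exp (- (u\<^sup>2 / 2))"
    using exp_ge_cubic[of "u\<^sup>2 / 2"] by simp
  then show ?thesis using cos_le_quartic[of u] by simp
qed

lemma abs_cos_le_exp_sin: "\<bar>cos (u::real)\<bar> \<le> exp (- (sin u)\<^sup>2 / 2)"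
proof -
  have "(cos u)\<^sup>2 \<le> exp (- (sin u)\<^sup>2)"
    using exp_ge_add_one_self[of "- (sin u)\<^sup>2"] by (simp add: cos_squared_eq)
  also have "\<dots> = (exp (- (sin u)\<^sup>2 / 2))\<^sup>2"
    by (simp flip: exp_double)
  finally have "\<bar>cos u\<bar> \<le> \<bar>exp (- (sin u)\<^sup>2 / 2)\<bar>" by (simp only: abs_le_square_iff)
  then show ?thesis by simp
qed

lemma sin_square_ge: "(sin (u::real))\<^sup>2 \<ge> u\<^sup>2 - u ^ 4 / 3"
  using cos_le_quartic[of "2 * u"] by (simp add: cos_double_sin power_mult_distrib)

lemma cos_ge_exp:
  assumes "\<bar>u::real\<bar> \<le> 1"
  shows "cos u \<ge> exp (- u\<^sup>2 / 2 - u ^ 4 / 2)"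
proof -
  have u: "u\<^sup>2 \<le> 1" using assms by (simp add: abs_square_le_1)
  have "- (u\<^sup>2 / 2) - 2 * (u\<^sup>2 / 2)\<^sup>2 \<le> ln (1 - u\<^sup>2 / 2)"
    using u by (intro ln_one_minus_pos_lower_bound) auto
  then have "exp (- (u\<^sup>2 / 2) - 2 * (u\<^sup>2 / 2)\<^sup>2) \<le> 1 - u\<^sup>2 / 2"
    using u by (subst (asm) ln_ge_iff) auto
  also have "\<dots> \<le> cos u" by (rule cos_ge_quadratic)
  finally show ?thesis
    by (simp add: power_divide flip: power_mult)
qed

section \<open>Bounds away from the origin, summed over matrices\<close>

text \<open>
  Cauchy-Schwarz passes from absolute values, which have no closed form average over the signs, to squares,
  which have one by \<open>sum_signs_cos_square\<close>.
\<close>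

lemma sum_signs_abs_le:
  assumes "(\<Sum>h\<in>signs k. (f h)\<^sup>2) \<le> 2 ^ k * exp (-1/12)"
  shows "(\<Sum>h\<in>signs k. \<bar>f h\<bar>) \<le> 2 ^ k * exp (-1/24 :: real)"
proof -
  have "(\<Sum>h\<in>signs k. \<bar>f h\<bar>)\<^sup>2 \<le> (\<Sum>h\<in>signs k. \<bar>f h\<bar>\<^sup>2) * card (signs k)"
    by (rule sum_squared_le_sum_of_squares)
  also have "\<dots> \<le> 2 ^ k * exp (-1/12) * 2 ^ k"
    using assms by (simp add: card_signs mult.commute)
  also have "\<dots> = (2 ^ k * exp (-1/24))\<^sup>2"
    by (simp add: power_mult_distrib power2_eq_square flip: exp_add)
  finally show ?thesis by (rule power2_le_imp_le) simp
qed

lemma sum_signs_cos_square: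
  "(\<Sum>h\<in>signs k. (cos (dot k \<theta> h))\<^sup>2) = 2 ^ k * ((1 + (\<Prod>i<k. cos (2 * \<theta> i))) / 2)"
proof -
  have "(\<Sum>h\<in>signs k. (cos (dot k \<theta> h))\<^sup>2)
      = (\<Sum>h\<in>signs k. 1 / 2 + cos (dot k (\<lambda>i. 2 * \<theta> i) h) / 2)"
  proof (rule sum.cong)
    fix h show "(cos (dot k \<theta> h))\<^sup>2 = 1 / 2 + cos (dot k (\<lambda>i. 2 * \<theta> i) h) / 2"
      using cos_double_cos[of "dot k \<theta> h"] by (simp add: dot_def sum_distrib_left mult.assoc diff_divide_distrib)
  qed simp
  also have "\<dots> = 2 ^ k / 2 + (2 ^ k * (\<Prod>i<k. cos (2 * \<theta> i))) / 2"
    by (simp add: sum.distrib card_signs sum_signs_cos flip: sum_divide_distrib)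
  finally show ?thesis by (simp add: algebra_simps)
qed

lemma sum_signs_abs_sin_le:
  assumes "\<And>i. i < k \<Longrightarrow> \<bar>\<theta> i\<bar> \<le> pi / 4"
  shows "(\<Sum>h\<in>signs k. \<bar>sin (dot k \<theta> h)\<bar>) \<le> 2 ^ k * exp (-1/24)"
proof (rule sum_signs_abs_le)
  have "0 \<le> (\<Prod>i<k. cos (2 * \<theta> i))"
  proof (intro prod_nonneg cos_ge_zero)
    fix i assume "i \<in> {..<k}"
    then have "\<bar>\<theta> i\<bar> \<le> pi / 4" using assms by simp
    then show "- (pi / 2) \<le> 2 * \<theta> i" "2 * \<theta> i \<le> pi / 2" by (auto simp: abs_le_iff)
  qed
  have "(\<Sum>h\<in>signs k. (sin (dot k \<theta> h))\<^sup>2) = 2 ^ k - (\<Sum>h\<in>signs k. (cos (dot k \<theta> h))\<^sup>2)"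
    by (simp add: sin_squared_eq sum_subtractf card_signs)
  also have "\<dots> \<le> 2 ^ k * (1 / 2)"
    unfolding sum_signs_cos_square using \<open>0 \<le> _\<close> by (simp add: field_simps)
  also have "\<dots> \<le> 2 ^ k * exp (-1/12)"
    using exp_ge_add_one_self[of "-1/12::real"] by (intro mult_left_mono) auto
  finally show "(\<Sum>h\<in>signs k. (sin (dot k \<theta> h))\<^sup>2) \<le> 2 ^ k * exp (-1/12)" .
qed

text \<open>
  At distance at least \<open>1/2\<close> from the origin the average of \<open>|cos \<langle>\<theta>, h\<rangle>|\<close> is bounded away from 1: doubling the
  angles in the cube keeps them in \<open>[-\<pi>/2, \<pi>/2]\<close>, where the product of the cosines decays like a Gaussian.
\<close>

lemma sum_signs_abs_cos_le:
  assumes "\<And>i. i < k \<Longrightarrow> \<bar>\<theta> i\<bar> \<le> pi / 4" and "sqnorm k \<theta> \<ge> 1 / 4"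
  shows "(\<Sum>h\<in>signs k. \<bar>cos (dot k \<theta> h)\<bar>) \<le> 2 ^ k * exp (-1/24)"
proof (rule sum_signs_abs_le)
  have "(\<Prod>i<k. cos (2 * \<theta> i)) \<le> (\<Prod>i<k. exp (- (2 * \<theta> i)\<^sup>2 / 2))"
  proof (intro prod_mono conjI)
    fix i assume "i \<in> {..<k}"
    then have "\<bar>\<theta> i\<bar> \<le> pi / 4" using assms by simp
    then show "0 \<le> cos (2 * \<theta> i)" by (intro cos_ge_zero) (auto simp: abs_le_iff)
    show "cos (2 * \<theta> i) \<le> exp (- (2 * \<theta> i)\<^sup>2 / 2)"
      using \<open>\<bar>\<theta> i\<bar> \<le> pi / 4\<close> pi_less_4 by (intro cos_le_exp) (simp add: abs_mult)
  qed
  also have "\<dots> = exp (- (2 * sqnorm k \<theta>))"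
    by (simp add: sqnorm_def sum_distrib_left power_mult_distrib flip: exp_sum sum_negf)
  also have "\<dots> \<le> exp (- (1 / 2))" using assms by simp
  also have "\<dots> \<le> 5 / 8" using exp_neg_le_quadratic[of "1/2"] by (simp add: power2_eq_square)
  finally have "(1 + (\<Prod>i<k. cos (2 * \<theta> i))) / 2 \<le> 11 / 12" by simp
  also have "\<dots> \<le> exp (-1/12::real)" using exp_ge_add_one_self[of "-1/12::real"] by simp
  finally show "(\<Sum>h\<in>signs k. (cos (dot k \<theta> h))\<^sup>2) \<le> 2 ^ k * exp (-1/12)"
    unfolding sum_signs_cos_square by (intro mult_left_mono) auto
qed

text \<open>
  The moment generating function behind the Chernoff bound. With \<open>v = |\<theta>|\<^sup>2\<close>, the variable
  \<open>sin\<^sup>2 \<langle>\<theta>, h\<rangle>\<close> is nonnegative with mean about \<open>v\<close> and, by Khinchine's inequality, second moment at most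
  \<open>3 v\<^sup>2\<close>. Since these scale together, the parameter \<open>1 / (6 v)\<close> gains a constant factor however small \<open>v\<close> is.
\<close>

lemma sum_signs_exp_sin_le:
  assumes "0 < sqnorm k \<theta>" "sqnorm k \<theta> \<le> 1 / 4"
  shows "(\<Sum>h\<in>signs k. exp (- ((sin (dot k \<theta> h))\<^sup>2 / (6 * sqnorm k \<theta>)))) \<le> 2 ^ k * exp (-1/12)"
proof -
  define v where "v = sqnorm k \<theta>"
  define l where "l = 1 / (6 * v)"
  have v: "0 < v" "v \<le> 1 / 4" using assms by (auto simp: v_def)
  have l: "l > 0" "l * v = 1 / 6" using v by (auto simp: l_def)
  have "(\<Sum>h\<in>signs k. exp (- ((sin (dot k \<theta> h))\<^sup>2 / (6 * sqnorm k \<theta>))))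
      = (\<Sum>h\<in>signs k. exp (- (l * (sin (dot k \<theta> h))\<^sup>2)))"
    by (simp add: l_def v_def)
  also have "\<dots> \<le> (\<Sum>h\<in>signs k. 1 - l * (dot k \<theta> h)\<^sup>2 + (l / 3 + l\<^sup>2 / 2) * (dot k \<theta> h) ^ 4)"
  proof (rule sum_mono)
    fix h
    let ?u = "dot k \<theta> h"
    have "(sin ?u)\<^sup>2 \<le> ?u\<^sup>2" using abs_sin_x_le_abs_x by (simp only: abs_le_square_iff)
    then have "((sin ?u)\<^sup>2)\<^sup>2 \<le> (?u\<^sup>2)\<^sup>2" by (rule power_mono) simp
    then have 4: "((sin ?u)\<^sup>2)\<^sup>2 \<le> ?u ^ 4" by (simp flip: power_mult)
    have "exp (- (l * (sin ?u)\<^sup>2)) \<le> 1 - l * (sin ?u)\<^sup>2 + (l * (sin ?u)\<^sup>2)\<^sup>2 / 2"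
      using l by (intro exp_neg_le_quadratic) simp
    also have "\<dots> = 1 - l * (sin ?u)\<^sup>2 + l\<^sup>2 / 2 * ((sin ?u)\<^sup>2)\<^sup>2" by (simp add: power_mult_distrib)
    also have "\<dots> \<le> 1 - l * (?u\<^sup>2 - ?u ^ 4 / 3) + l\<^sup>2 / 2 * ?u ^ 4"
      using l 4 sin_square_ge[of ?u] by (intro add_mono diff_mono mult_left_mono) auto
    also have "\<dots> = 1 - l * ?u\<^sup>2 + (l / 3 + l\<^sup>2 / 2) * ?u ^ 4" by (simp add: algebra_simps)
    finally show "exp (- (l * (sin ?u)\<^sup>2)) \<le> 1 - l * ?u\<^sup>2 + (l / 3 + l\<^sup>2 / 2) * ?u ^ 4" .
  qed
  also have "\<dots> = 2 ^ k - l * (2 ^ k * v) + (l / 3 + l\<^sup>2 / 2) * (\<Sum>h\<in>signs k. (dot k \<theta> h) ^ 4)"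
    by (simp add: sum.distrib sum_subtractf card_signs sum_signs_square v_def flip: sum_distrib_left)
  also have "\<dots> \<le> 2 ^ k - l * (2 ^ k * v) + (l / 3 + l\<^sup>2 / 2) * (2 ^ k * (3 * v\<^sup>2))"
    using l sum_signs_fourth[of k \<theta>] by (intro add_left_mono mult_left_mono) (auto simp: v_def)
  also have "\<dots> = 2 ^ k * (1 - l * v + l * v * v + 3 / 2 * (l * v)\<^sup>2)"
    by (simp add: algebra_simps power2_eq_square)
  also have "\<dots> \<le> 2 ^ k * (1 - 1 / 12)"
    unfolding l using v by (intro mult_left_mono) (auto simp: power2_eq_square)
  also have "\<dots> \<le> 2 ^ k * exp (-1/12)"
    using exp_ge_add_one_self[of "-1/12::real"] by (intro mult_left_mono) auto
  finally show ?thesis .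
qed

text \<open>
  The orthogonality of the rows is dropped here, which makes the columns independent.
\<close>

lemma sum_hadamards_prod_le:
  assumes f: "\<And>h. f h \<ge> 0" and le: "(\<Sum>h\<in>signs k. f h) \<le> 2 ^ k * exp (-1/24 :: real)"
  shows "(\<Sum>H\<in>hadamards k s. \<Prod>j<s. f (H j)) \<le> 2 ^ (k * s) * exp (- real s / 24)"
proof -
  have "(\<Sum>H\<in>hadamards k s. \<Prod>j<s. f (H j)) \<le> (\<Sum>H\<in>sign_matrices k s. \<Prod>j<s. f (H j))"
    using f by (intro sum_mono2) (auto simp: hadamards_def intro!: prod_nonneg)
  also have "\<dots> \<le> (2 ^ k * exp (-1/24)) ^ s"
    unfolding sum_sign_matrices_prod using le by (intro power_mono sum_nonneg f)
  also have "\<dots> = 2 ^ (k * s) * exp (- real s / 24)"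
    by (simp add: power_mult_distrib power_mult flip: exp_of_nat_mult)
  finally show ?thesis .
qed

lemma sum_hadamards_sin_le:
  assumes "\<And>i. i < k \<Longrightarrow> \<bar>\<theta> i\<bar> \<le> pi / 4"
  shows "(\<Sum>H\<in>hadamards k s. \<Prod>j<s. \<bar>sin (dot k \<theta> (H j))\<bar>) \<le> 2 ^ (k * s) * exp (- real s / 24)"
  using sum_signs_abs_sin_le[OF assms] by (intro sum_hadamards_prod_le) auto

text \<open>
  For small \<open>\<theta>\<close>, either \<open>\<Sum>\<^sub>j sin\<^sup>2 \<langle>\<theta>, h\<^sub>j\<rangle>\<close> is at least a quarter of its expected size, and then the cosine
  product is small, or the matrix is one of the exceptional ones counted by Markov's inequality for the product
  of the exponential weights. For large \<open>\<theta>\<close> the average of a single factor is already small.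
\<close>

lemma sum_hadamards_cos_le:
  assumes \<theta>: "\<And>i. i < k \<Longrightarrow> \<bar>\<theta> i\<bar> \<le> pi / 4"
  shows "(\<Sum>H\<in>hadamards k s. \<Prod>j<s. \<bar>cos (dot k \<theta> (H j))\<bar>)
    \<le> card (hadamards k s) * exp (- (s * sqnorm k \<theta> / 8)) + 2 ^ (k * s) * exp (- real s / 24)"
proof -
  define v where "v = sqnorm k \<theta>"
  have "v \<ge> 0" by (simp add: v_def sqnorm_def sum_nonneg)
  then consider "v = 0" | "v \<ge> 1 / 4" | "0 < v" "v < 1 / 4" by linarith
  then show ?thesis
  proof cases
    case 1
    have "(\<Sum>H\<in>hadamards k s. \<Prod>j<s. \<bar>cos (dot k \<theta> (H j))\<bar>) \<le> (\<Sum>H\<in>hadamards k s. 1)"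
      by (intro sum_mono prod_le_1) auto
    then show ?thesis using 1 by (simp add: v_def add_increasing2)
  next
    case 2
    then have "(\<Sum>H\<in>hadamards k s. \<Prod>j<s. \<bar>cos (dot k \<theta> (H j))\<bar>) \<le> 2 ^ (k * s) * exp (- real s / 24)"
      using sum_signs_abs_cos_le[OF \<theta>] by (intro sum_hadamards_prod_le) (auto simp: v_def)
    then show ?thesis by (simp add: add_increasing)
  next
    case 3
    \<comment> \<open>The product of these weights is at least 1 on the exceptional matrices, where
      the sum of the squared sines is below \<open>s v / 4\<close>: the factor \<open>1/24\<close> is \<open>(v / 4) / (6 v)\<close>.\<close>
    define g where "g h = exp (1/24) * exp (- ((sin (dot k \<theta> h))\<^sup>2 / (6 * v)))" for h
    have "(\<Prod>j<s. \<bar>cos (dot k \<theta> (H j))\<bar>) \<le> exp (- (s * v / 8)) + (\<Prod>j<s. g (H j))" for H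
    proof -
      define T where "T = (\<Sum>j<s. (sin (dot k \<theta> (H j)))\<^sup>2)"
      have T: "T \<ge> 0" by (simp add: T_def sum_nonneg)
      have "(\<Prod>j<s. \<bar>cos (dot k \<theta> (H j))\<bar>) \<le> (\<Prod>j<s. exp (- (sin (dot k \<theta> (H j)))\<^sup>2 / 2))"
        by (intro prod_mono conjI abs_cos_le_exp_sin) auto
      also have "\<dots> = exp (- T / 2)"
        by (simp add: T_def sum_divide_distrib sum_negf flip: exp_sum)
      finally have 1: "(\<Prod>j<s. \<bar>cos (dot k \<theta> (H j))\<bar>) \<le> exp (- T / 2)" .
      have 2: "(\<Prod>j<s. g (H j)) = exp (real s / 24 - T / (6 * v))"
      proof -
        have "(\<Prod>j<s. g (H j)) = exp (1/24) ^ s * exp (- T / (6 * v))"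
          unfolding g_def
          by (simp add: prod.distrib T_def sum_divide_distrib sum_negf flip: exp_sum)
        then show ?thesis by (simp flip: exp_of_nat_mult exp_add)
      qed
      show ?thesis
      proof (cases "T \<ge> s * v / 4")
        case True
        then have "exp (- T / 2) \<le> exp (- (s * v / 8))" by (simp add: field_simps)
        moreover have "0 \<le> exp (real s / 24 - T / (6 * v))" by simp
        ultimately show ?thesis using 1 unfolding 2 by linarith
      next
        case False
        then have "T / (6 * v) \<le> real s / 24" using 3 by (simp add: field_simps)
        then have "1 \<le> exp (real s / 24 - T / (6 * v))" by simp
        moreover have "exp (- T / 2) \<le> 1" using T by simp
        moreover have "0 \<le> exp (- (s * v / 8))" by simp
        ultimately show ?thesis using 1 unfolding 2 by linarith
      qed
    qed
    then have "(\<Sum>H\<in>hadamards k s. \<Prod>j<s. \<bar>cos (dot k \<theta> (H j))\<bar>)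
        \<le> (\<Sum>H\<in>hadamards k s. exp (- (s * v / 8)) + (\<Prod>j<s. g (H j)))"
      by (intro sum_mono)
    also have "\<dots> = card (hadamards k s) * exp (- (s * v / 8)) + (\<Sum>H\<in>hadamards k s. \<Prod>j<s. g (H j))"
      by (simp add: sum.distrib)
    also have "(\<Sum>H\<in>hadamards k s. \<Prod>j<s. g (H j)) \<le> 2 ^ (k * s) * exp (- real s / 24)"
    proof (rule sum_hadamards_prod_le)
      have "(\<Sum>h\<in>signs k. g h) = exp (1/24) * (\<Sum>h\<in>signs k. exp (- ((sin (dot k \<theta> h))\<^sup>2 / (6 * v))))"
        by (simp add: g_def sum_distrib_left)
      also have "\<dots> \<le> exp (1/24) * (2 ^ k * exp (-1/12))"
        using sum_signs_exp_sin_le[of k \<theta>] 3 by (intro mult_left_mono) (auto simp: v_def)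
      also have "\<dots> = 2 ^ k * exp (-1/24)" by (simp flip: exp_add)
      finally show "(\<Sum>h\<in>signs k. g h) \<le> 2 ^ k * exp (-1/24)" .
    qed (simp add: g_def)
    finally show ?thesis by (simp add: v_def)
  qed
qed

section \<open>Fourier inversion on a small cube\<close>

abbreviation Leb :: "nat \<Rightarrow> (nat \<Rightarrow> real) measure" where
  "Leb k \<equiv> Pi\<^sub>M {..<k} (\<lambda>_. lborel)"

text \<open>
  A real-valued indicator in product form, so that cube integrals of characters factor over the coordinates.
\<close>

definition cube :: "nat \<Rightarrow> (nat \<Rightarrow> real) \<Rightarrow> real" where
  "cube k \<theta> = (\<Prod>i<k. indicator {-pi/4..pi/4} (\<theta> i))"

interpretation lborel_prod: product_sigma_finite "\<lambda>_::nat. lborel :: real measure"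
  by unfold_locales

lemma measurable_dot [measurable]: "(\<lambda>\<theta>. dot k \<theta> h) \<in> borel_measurable (Leb k)"
  unfolding dot_def by measurable

lemma measurable_sqnorm [measurable]: "sqnorm k \<in> borel_measurable (Leb k)"
  unfolding sqnorm_def by measurable

lemma measurable_cube [measurable]: "cube k \<in> borel_measurable (Leb k)"
  unfolding cube_def by measurable

lemma cube_cases: "cube k \<theta> = (if \<forall>i<k. \<bar>\<theta> i\<bar> \<le> pi / 4 then 1 else 0)"
proof (cases "\<forall>i<k. \<bar>\<theta> i\<bar> \<le> pi / 4")
  case True
  then have "cube k \<theta> = (\<Prod>i<k. 1)"
    unfolding cube_def by (intro prod.cong) (auto simp: indicator_def abs_le_iff)
  then show ?thesis using True by simp
next
  case False
  then obtain i where i: "i < k" "\<not> \<bar>\<theta> i\<bar> \<le> pi / 4" by blast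
  then have "indicator {-pi/4..pi/4} (\<theta> i) = (0::real)" by (auto simp: indicator_def abs_le_iff)
  then have "cube k \<theta> = 0" unfolding cube_def using i(1) by (intro prod_zero) auto
  then show ?thesis using False by simp
qed

lemma integrable_cube: "integrable (Leb k) (cube k)"
  unfolding cube_def by (intro lborel_prod.product_integrable_prod) auto

lemma integral_cube: "(\<integral>\<theta>. cube k \<theta> \<partial>Leb k) = (pi / 2) ^ k"
  unfolding cube_def by (subst lborel_prod.product_integral_prod) auto

text \<open>
  The characters with frequencies in \<open>4\<int>\<close> are orthogonal on an interval of length \<open>\<pi>/2\<close>.
\<close>

lemma cis_mult_integral:
  assumes "S = 4 * real_of_int m"
  shows "integrable lborel (\<lambda>t. indicator {-pi/4..pi/4} t *\<^sub>R cis (S * t))"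
    and "(\<integral>t. indicator {-pi/4..pi/4} t *\<^sub>R cis (S * t) \<partial>lborel) = (if S = 0 then of_real (pi / 2) else 0)"
proof -
  show "integrable lborel (\<lambda>t. indicator {-pi/4..pi/4} t *\<^sub>R cis (S * t))"
    by (rule borel_integrable_compact) (auto intro!: continuous_intros)
  show "(\<integral>t. indicator {-pi/4..pi/4} t *\<^sub>R cis (S * t) \<partial>lborel) = (if S = 0 then of_real (pi / 2) else 0)"
  proof (cases "S = 0")
    case True
    then have "(\<integral>t. indicator {-pi/4..pi/4} t *\<^sub>R cis (S * t) \<partial>lborel) = (\<integral>t. of_real (indicator {-pi/4..pi/4} t) \<partial>lborel)"
      by (simp add: scaleR_conv_of_real)
    also have "\<dots> = of_real (pi / 2)" by (subst integral_complex_of_real) simp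
    finally show ?thesis using True by simp
  next
    case False
    define F where "F t = cis (S * t) * (- \<i> / of_real S)" for t
    have "(F has_vector_derivative cis (S * x)) (at x within {-pi/4..pi/4})" for x
    proof -
      have "((\<lambda>z. exp (\<i> * of_real S * z) * (- \<i> / of_real S)) has_field_derivative
          exp (\<i> * of_real S * of_real x)) (at (of_real x))"
        using False by (auto intro!: derivative_eq_intros)
      from has_vector_derivative_real_field[OF this] show ?thesis
        by (simp add: F_def[abs_def] cis_conv_exp mult.assoc)
    qed
    then have "(\<integral>t. indicator {-pi/4..pi/4} t *\<^sub>R cis (S * t) \<partial>lborel) = F (pi/4) - F (-pi/4)"
      by (intro integral_FTC_Icc) (auto intro!: continuous_intros)
    also have "\<dots> = 0"
    proof -
      have "cis (S * (pi / 4)) = cis (S * (- pi / 4))"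
      proof -
        have "cis (S * (pi / 4)) = cis (S * (- pi / 4) + 2 * pi * of_int m)"
          by (simp add: assms algebra_simps)
        also have "\<dots> = cis (S * (- pi / 4)) * cis (2 * pi * of_int m)" by (simp only: cis_mult)
        also have "cis (2 * pi * of_int m) = 1" by (rule cis_multiple_2pi) simp
        finally show ?thesis by simp
      qed
      then show ?thesis by (simp add: F_def)
    qed
    finally show ?thesis using False by simp
  qed
qed

lemma integrable_cube_mult:
  fixes g :: "(nat \<Rightarrow> real) \<Rightarrow> 'a::{banach, second_countable_topology}"
  assumes "g \<in> borel_measurable (Leb k)" and "\<And>\<theta>. norm (g \<theta>) \<le> B"
  shows "integrable (Leb k) (\<lambda>\<theta>. cube k \<theta> *\<^sub>R g \<theta>)"
proof (rule Bochner_Integration.integrable_bound)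
  show "integrable (Leb k) (\<lambda>\<theta>. B * cube k \<theta>)" using integrable_cube by simp
  show "AE \<theta> in Leb k. norm (cube k \<theta> *\<^sub>R g \<theta>) \<le> norm (B * cube k \<theta>)"
    using assms(2) by (auto simp: cube_cases intro: order_trans[OF _ abs_ge_self])
qed (use assms(1) in measurable)

lemma sum_int_multiples:
  fixes f :: "'a \<Rightarrow> real"
  assumes "finite A" "\<And>j. j \<in> A \<Longrightarrow> \<exists>m::int. f j = r * real_of_int m"
  shows "\<exists>m::int. sum f A = r * real_of_int m"
proof -
  obtain m :: "'a \<Rightarrow> int" where "\<And>j. j \<in> A \<Longrightarrow> f j = r * real_of_int (m j)" using assms(2) by metis
  then have "sum f A = r * real_of_int (sum m A)" by (simp add: sum_distrib_left)
  then show ?thesis by blast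
qed

text \<open>
  The entries of \<open>H x\<close> are congruent modulo 4: for signs \<open>x, a, b\<close> one has \<open>x a - x b \<equiv> 1 - a b\<close> modulo 4, and
  the sum of \<open>1 - a b\<close> over the columns is \<open>4t\<close> because two rows are orthogonal.
\<close>

lemma hadamard_sign_product_mod4:
  assumes H: "H \<in> hadamards k (4 * t)" and x: "x \<in> signs (4 * t)" and i: "i < k"
  shows "\<exists>m::int. (\<Sum>j<4*t. x j * H j i) = (\<Sum>j<4*t. x j * H j 0) + 4 * real_of_int m"
proof (cases "i = 0")
  case True
  then show ?thesis by (intro exI[of _ 0]) simp
next
  case False
  have "\<exists>m::int. (\<Sum>j<4*t. (x j * H j i - x j * H j 0) - (1 - H j i * H j 0)) = 4 * real_of_int m"
  proof (rule sum_int_multiples)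
    fix j assume "j \<in> {..<4 * t}"
    then have j: "j < 4 * t" by simp
    have h: "H j \<in> signs k" by (rule sign_matrices_nth[OF hadamards_sign_matrices[OF H] j])
    consider "(x j * H j i - x j * H j 0) - (1 - H j i * H j 0) = 0"
      | "(x j * H j i - x j * H j 0) - (1 - H j i * H j 0) = -4"
      using signs_cases[OF x j] signs_cases[OF h i] signs_cases[OF h, of 0] i by fastforce
    then show "\<exists>m::int. (x j * H j i - x j * H j 0) - (1 - H j i * H j 0) = 4 * real_of_int m"
      by cases (auto intro: exI[of _ 0] exI[of _ "-1"])
  qed simp
  then obtain m :: int where m: "(\<Sum>j<4*t. (x j * H j i - x j * H j 0) - (1 - H j i * H j 0)) = 4 * real_of_int m"
    by blast
  have "(\<Sum>j<4*t. H j i * H j 0) = 0" using H i False by (simp add: hadamards_def)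
  with m have "(\<Sum>j<4*t. x j * H j i) = (\<Sum>j<4*t. x j * H j 0) + 4 * real_of_int (m + int t)"
    by (simp add: sum_subtractf)
  then show ?thesis by blast
qed

lemma sign_product_even:
  assumes H: "H \<in> sign_matrices k (4 * t)" and x: "x \<in> signs (4 * t)" and i: "i < k"
  shows "\<exists>m::int. (\<Sum>j<4*t. x j * H j i) = 2 * real_of_int m"
proof -
  have "\<exists>m::int. (\<Sum>j<4*t. x j * H j i - 1) = 2 * real_of_int m"
  proof (rule sum_int_multiples)
    fix j assume "j \<in> {..<4 * t}"
    then have j: "j < 4 * t" by simp
    have h: "H j \<in> signs k" by (rule sign_matrices_nth[OF H j])
    consider "x j * H j i - 1 = 0" | "x j * H j i - 1 = -2"
      using signs_cases[OF x j] signs_cases[OF h i] by fastforce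
    then show "\<exists>m::int. x j * H j i - 1 = 2 * real_of_int m"
      by cases (auto intro: exI[of _ 0] exI[of _ "-1"])
  qed simp
  then obtain m :: int where m: "(\<Sum>j<4*t. x j * H j i - 1) = 2 * real_of_int m" by blast
  then have "(\<Sum>j<4*t. x j * H j i) = 2 * real_of_int (m + 2 * int t)" by (simp add: sum_subtractf)
  then show ?thesis by blast
qed

lemma cube_fourier:
  assumes "\<And>i. i < k \<Longrightarrow> \<exists>m::int. S i = 4 * real_of_int m"
  shows "(\<integral>\<theta>. cube k \<theta> *\<^sub>R cis (\<Sum>i<k. S i * \<theta> i) \<partial>Leb k)
    = (if \<forall>i<k. S i = 0 then of_real ((pi / 2) ^ k) else 0)"
proof -
  have "(\<integral>\<theta>. cube k \<theta> *\<^sub>R cis (\<Sum>i<k. S i * \<theta> i) \<partial>Leb k)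
      = (\<integral>\<theta>. (\<Prod>i<k. indicator {-pi/4..pi/4} (\<theta> i) *\<^sub>R cis (S i * \<theta> i)) \<partial>Leb k)"
    by (simp add: cube_def scaleR_conv_of_real prod.distrib cis_conv_exp exp_sum sum_distrib_left)
  also have "\<dots> = (\<Prod>i<k. \<integral>t. indicator {-pi/4..pi/4} t *\<^sub>R cis (S i * t) \<partial>lborel)"
  proof (rule lborel_prod.product_integral_prod)
    fix i assume "i \<in> {..<k}"
    then obtain m :: int where "S i = 4 * real_of_int m" using assms by auto
    then show "integrable lborel (\<lambda>t. indicator {-pi/4..pi/4} t *\<^sub>R cis (S i * t))"
      by (rule cis_mult_integral(1))
  qed simp
  also have "\<dots> = (\<Prod>i<k. if S i = 0 then of_real (pi / 2) else 0)"
  proof (intro prod.cong refl)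
    fix i assume "i \<in> {..<k}"
    then obtain m :: int where "S i = 4 * real_of_int m" using assms by auto
    then show "(\<integral>t. indicator {-pi/4..pi/4} t *\<^sub>R cis (S i * t) \<partial>lborel)
        = (if S i = 0 then of_real (pi / 2) else 0)"
      by (rule cis_mult_integral(2))
  qed
  also have "\<dots> = (if \<forall>i<k. S i = 0 then of_real ((pi / 2) ^ k) else 0)"
  proof (cases "\<forall>i<k. S i = 0")
    case False
    then show ?thesis by (auto intro: prod_zero)
  qed simp
  finally show ?thesis .
qed

definition cos_prod :: "nat \<Rightarrow> nat \<Rightarrow> (nat \<Rightarrow> nat \<Rightarrow> real) \<Rightarrow> (nat \<Rightarrow> real) \<Rightarrow> real" where
  "cos_prod k s H \<theta> = (\<Prod>j<s. cos (dot k \<theta> (H j)))"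

text \<open>
  The cosine product translated by \<open>\<pi>/2\<close> in the first coordinate, the only translate that the modulo 4
  congruences leave over besides the cosine product itself.
\<close>

definition shifted_prod :: "nat \<Rightarrow> nat \<Rightarrow> (nat \<Rightarrow> nat \<Rightarrow> real) \<Rightarrow> (nat \<Rightarrow> real) \<Rightarrow> real" where
  "shifted_prod k s H \<theta> = (\<Prod>j<s. cos (dot k \<theta> (H j) + H j 0 * (pi / 2)))"

lemma measurable_cos_prod [measurable]: "cos_prod k s H \<in> borel_measurable (Leb k)"
  unfolding cos_prod_def by measurable

lemma measurable_shifted_prod [measurable]: "shifted_prod k s H \<in> borel_measurable (Leb k)"
  unfolding shifted_prod_def by measurable

lemma integrable_cube_cos_prod: "integrable (Leb k) (\<lambda>\<theta>. cube k \<theta> * cos_prod k s H \<theta>)"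
  using integrable_cube_mult[of "cos_prod k s H" k 1]
  by (simp add: cos_prod_def abs_prod prod_le_1)

lemma integrable_cube_shifted_prod: "integrable (Leb k) (\<lambda>\<theta>. cube k \<theta> * shifted_prod k s H \<theta>)"
  using integrable_cube_mult[of "shifted_prod k s H" k 1]
  by (simp add: shifted_prod_def abs_prod prod_le_1)

text \<open>
  If one entry of \<open>H x\<close> is divisible by 4 then all are, and the cube integral of the character with frequency
  vector \<open>H x\<close> detects whether \<open>H x = 0\<close>. Otherwise all are 2 modulo 4; the factor
  \<open>(1 + cis (\<pi>/2 \<cdot> (H x)\<^sub>0)) / 2\<close> removes this case. Expanding this factor and summing over \<open>x\<close> yields the two
  products.
\<close>

lemma card_orth_signs_integral:
  assumes H: "H \<in> hadamards k (4 * t)" and k: "k \<ge> 1"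
  defines "s \<equiv> 4 * t"
  shows "real (card (orth_signs k s H)) * (pi / 2) ^ k
    = 2 ^ s * (\<integral>\<theta>. cube k \<theta> * ((cos_prod k s H \<theta> + shifted_prod k s H \<theta>) / 2) \<partial>Leb k)"
proof -
  define S where "S x i = (\<Sum>j<s. x j * H j i)" for x i
  \<comment> \<open>The first factor is 1 or 0 as the first entry of \<open>H x\<close> is 0 or 2 modulo 4.\<close>
  define G where "G x \<theta> = (1 + cis (S x 0 * (pi / 2))) / 2 * cis (\<Sum>i<k. S x i * \<theta> i)" for x \<theta>
  have G: "(\<integral>\<theta>. cube k \<theta> *\<^sub>R G x \<theta> \<partial>Leb k) = of_real ((pi / 2) ^ k * of_bool (x \<in> orth_signs k s H))"
    if x: "x \<in> signs s" for x
  proof -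
    obtain m :: int where m: "S x 0 = 2 * real_of_int m"
      using sign_product_even[OF hadamards_sign_matrices[OF H] x[unfolded s_def], of 0] k
      by (auto simp: S_def s_def)
    have d: "\<exists>l::int. S x i = S x 0 + 4 * real_of_int l" if "i < k" for i
      using hadamard_sign_product_mod4[OF H x[unfolded s_def] that] by (simp add: S_def s_def)
    have o: "x \<in> orth_signs k s H \<longleftrightarrow> (\<forall>i<k. S x i = 0)"
      using x by (simp add: orth_signs_def S_def)
    have c: "cis (S x 0 * (pi / 2)) = (if even m then 1 else -1)"
      by (cases "even m") (auto simp: m complex_eq_iff mult.commute cos_int_times_real sin_int_times_real elim!: evenE oddE)
    have Gx: "G x = (\<lambda>\<theta>. if even m then cis (\<Sum>i<k. S x i * \<theta> i) else 0)"
      unfolding G_def c by (simp add: fun_eq_iff)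
    show ?thesis
    proof (cases "even m")
      case True
      then obtain n where "m = 2 * n" by blast
      then have "\<exists>l::int. S x i = 4 * real_of_int l" if "i < k" for i
        using d[OF that] by (auto simp: m intro: exI[of _ "n + _"])
      from cube_fourier[OF this] show ?thesis using True by (simp add: Gx o)
    next
      case False
      then have "m \<noteq> 0" by auto
      then have "x \<notin> orth_signs k s H" unfolding o using k m by (auto intro!: exI[of _ 0])
      then show ?thesis using False by (simp add: Gx)
    qed
  qed
  have int: "integrable (Leb k) (\<lambda>\<theta>. cube k \<theta> *\<^sub>R G x \<theta>)" for x
  proof (rule integrable_cube_mult)
    show "G x \<in> borel_measurable (Leb k)" unfolding G_def cis_conv_exp by measurable
    show "norm (G x \<theta>) \<le> 1" for \<theta>
      using norm_triangle_ineq[of 1 "cis (S x 0 * (pi / 2))"] by (simp add: G_def norm_mult norm_divide)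
  qed
  have sumG: "(\<Sum>x\<in>signs s. G x \<theta>) = of_real (2 ^ s * ((cos_prod k s H \<theta> + shifted_prod k s H \<theta>) / 2))" for \<theta>
  proof -
    have ph: "(\<Sum>i<k. S x i * \<theta> i) = (\<Sum>j<s. x j * dot k \<theta> (H j))" for x
      unfolding S_def dot_def sum_distrib_left sum_distrib_right
      by (subst sum.swap) (simp add: mult_ac)
    have ph': "S x 0 * (pi / 2) + (\<Sum>i<k. S x i * \<theta> i)
        = (\<Sum>j<s. x j * (dot k \<theta> (H j) + H j 0 * (pi / 2)))" for x
      unfolding ph by (simp add: S_def sum_distrib_right sum.distrib distrib_left mult.assoc)
    have "G x \<theta> = (cis (\<Sum>j<s. x j * dot k \<theta> (H j))
        + cis (\<Sum>j<s. x j * (dot k \<theta> (H j) + H j 0 * (pi / 2)))) / 2" for x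
      unfolding G_def ph'[symmetric] cis_mult[symmetric] ph[symmetric] by (simp add: algebra_simps)
    then have "(\<Sum>x\<in>signs s. G x \<theta>) = ((\<Sum>x\<in>signs s. cis (\<Sum>j<s. x j * dot k \<theta> (H j)))
        + (\<Sum>x\<in>signs s. cis (\<Sum>j<s. x j * (dot k \<theta> (H j) + H j 0 * (pi / 2))))) / 2"
      by (simp add: sum.distrib add_divide_distrib sum_divide_distrib)
    then show ?thesis
      unfolding sum_signs_cis
      by (simp add: cos_prod_def shifted_prod_def prod.distrib distrib_left)
  qed
  have "complex_of_real (real (card (orth_signs k s H)) * (pi / 2) ^ k)
      = (\<Sum>x\<in>signs s. of_real ((pi / 2) ^ k * of_bool (x \<in> orth_signs k s H)))"
  proof -
    have "real (card (orth_signs k s H)) = (\<Sum>x\<in>signs s. of_bool (x \<in> orth_signs k s H))"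
      by (simp add: orth_signs_def of_bool_def sum.If_cases Int_def conj_commute)
    also have "\<dots> * (pi / 2) ^ k = (\<Sum>x\<in>signs s. (pi / 2) ^ k * of_bool (x \<in> orth_signs k s H))"
      unfolding sum_distrib_right by (intro sum.cong refl mult.commute)
    finally show ?thesis by (simp only: of_real_sum)
  qed
  also have "\<dots> = (\<Sum>x\<in>signs s. (\<integral>\<theta>. cube k \<theta> *\<^sub>R G x \<theta> \<partial>Leb k))"
    by (intro sum.cong refl G[symmetric])
  also have "\<dots> = (\<integral>\<theta>. (\<Sum>x\<in>signs s. cube k \<theta> *\<^sub>R G x \<theta>) \<partial>Leb k)"
    by (rule Bochner_Integration.integral_sum[symmetric]) (rule int)
  also have "\<dots> = (\<integral>\<theta>. complex_of_real (2 ^ s * (cube k \<theta> * ((cos_prod k s H \<theta> + shifted_prod k s H \<theta>) / 2))) \<partial>Leb k)"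
    unfolding scaleR_sum_right[symmetric] sumG
    by (intro Bochner_Integration.integral_cong refl) (simp add: scaleR_conv_of_real)
  also have "\<dots> = complex_of_real (2 ^ s * (\<integral>\<theta>. cube k \<theta> * ((cos_prod k s H \<theta> + shifted_prod k s H \<theta>) / 2) \<partial>Leb k))"
    by (simp add: integral_complex_of_real del: of_real_mult of_real_power)
  finally show ?thesis by (simp only: of_real_eq_iff)
qed

section \<open>Gaussian integrals\<close>

lemma gaussian_mgf:
  assumes c: "c > 0"
  shows "has_bochner_integral lborel (\<lambda>t. exp (- c * t\<^sup>2 + a * t)) (sqrt (pi / c) * exp (a\<^sup>2 / (4 * c)))"
proof -
  define \<sigma> where "\<sigma> = sqrt (1 / (2 * c))"
  have \<sigma>: "\<sigma>\<^sup>2 = 1 / (2 * c)" using c by (simp add: \<sigma>_def)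
  define B where "B = sqrt (pi / c) * exp (a\<^sup>2 / (4 * c))"
  have "exp (- c * t\<^sup>2 + a * t) = B * normal_density (a / (2 * c)) \<sigma> t" for t
  proof -
    have "normal_density (a / (2 * c)) \<sigma> t = exp (- c * (t - a / (2 * c))\<^sup>2) / sqrt (pi / c)"
      using c by (simp add: normal_density_def \<sigma>)
    then have "B * normal_density (a / (2 * c)) \<sigma> t = exp (a\<^sup>2 / (4 * c)) * exp (- c * (t - a / (2 * c))\<^sup>2)"
      using c by (simp add: B_def)
    also have "\<dots> = exp (- c * t\<^sup>2 + a * t)"
      using c by (simp flip: exp_add) (simp add: field_simps power2_eq_square)
    finally show ?thesis by simp
  qed
  moreover have "has_bochner_integral lborel (\<lambda>t. B * normal_density (a / (2 * c)) \<sigma> t) (B * 1)"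
    using c by (intro has_bochner_integral_mult_right) (simp add: has_bochner_integral_iff \<sigma>_def)
  ultimately show ?thesis by (simp add: B_def)
qed

lemma gaussian_product_mgf:
  assumes c: "c > 0" and h: "h \<in> signs k"
  shows "has_bochner_integral (Leb k) (\<lambda>\<theta>. exp (- (c * sqnorm k \<theta>) + a * dot k \<theta> h))
    (sqrt (pi / c) ^ k * exp (k * a\<^sup>2 / (4 * c)))"
proof -
  have e: "exp (- (c * sqnorm k \<theta>) + a * dot k \<theta> h)
      = (\<Prod>i<k. exp (- c * (\<theta> i)\<^sup>2 + (a * h i) * \<theta> i))" for \<theta>
    by (simp add: sqnorm_def dot_def sum_distrib_left sum.distrib sum_subtractf mult_ac flip: exp_sum)
  have sq: "(a * h i)\<^sup>2 = a\<^sup>2" if "i < k" for i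
    using signs_cases[OF h that] by (auto simp: power_mult_distrib)
  have "(\<integral>\<theta>. (\<Prod>i<k. exp (- c * (\<theta> i)\<^sup>2 + (a * h i) * \<theta> i)) \<partial>Leb k)
      = (\<Prod>i<k. \<integral>t. exp (- c * t\<^sup>2 + (a * h i) * t) \<partial>lborel)"
    using gaussian_mgf[OF c] unfolding has_bochner_integral_iff
    by (intro lborel_prod.product_integral_prod) blast+
  also have "\<dots> = (\<Prod>i<k. sqrt (pi / c) * exp (a\<^sup>2 / (4 * c)))"
    using gaussian_mgf[OF c, THEN has_bochner_integral_integral_eq] sq by (intro prod.cong) simp_all
  also have "\<dots> = sqrt (pi / c) ^ k * exp (k * a\<^sup>2 / (4 * c))"
    by (simp add: power_mult_distrib flip: exp_of_nat_mult)
  finally show ?thesis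
    unfolding e has_bochner_integral_iff
    using gaussian_mgf[OF c] unfolding has_bochner_integral_iff
    by (auto intro!: lborel_prod.product_integrable_prod)
qed

lemma gaussian_integral:
  assumes "c > 0"
  shows "has_bochner_integral (Leb k) (\<lambda>\<theta>. exp (- (c * sqnorm k \<theta>))) (sqrt (pi / c) ^ k)"
proof -
  have "(\<lambda>i\<in>{..<k}. 1) \<in> signs k" by (simp add: signs_def)
  from gaussian_product_mgf[OF assms this, of 0] show ?thesis by simp
qed

lemma fourth_power_le_cosh: "(x::real) ^ 4 \<le> 12 * (exp x + exp (- x))"
proof -
  have 6: "{..<6::nat} = {0, 1, 2, 3, 4, 5}" by auto
  have ge: "exp v \<ge> 1 + v + v\<^sup>2 / 2 + v ^ 3 / 6 + v ^ 4 / 24 + v ^ 5 / 120" for v :: real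
  proof -
    obtain t where t: "exp v = (\<Sum>m<6. v ^ m / fact m) + (exp t / fact 6) * v ^ 6"
      using Maclaurin_exp_le[of v 6] by blast
    have "0 \<le> (exp t / fact 6) * v ^ 6" by simp
    then show ?thesis unfolding t by (simp add: 6 fact_numeral)
  qed
  have "2 + x\<^sup>2 + x ^ 4 / 12 \<le> exp x + exp (- x)" using ge[of x] ge[of "- x"] by simp
  then have "12 * (2 + x\<^sup>2 + x ^ 4 / 12) \<le> 12 * (exp x + exp (- x))" by (rule mult_left_mono) simp
  moreover have "x ^ 4 \<le> 12 * (2 + x\<^sup>2 + x ^ 4 / 12)" by (simp add: distrib_left)
  ultimately show ?thesis by (rule order_trans[rotated])
qed

text \<open>
  The fourth moment is bounded through the moment generating function, which factors over the coordinates, by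
  \<open>x\<^sup>4 \<le> 24 cosh x\<close>; scaling \<open>\<langle>\<theta>, h\<rangle>\<close> to constant standard deviation gives the right order \<open>(k / c)\<^sup>2\<close>.
\<close>

lemma gaussian_fourth_moment:
  assumes c: "c > 0" and h: "h \<in> signs k" and k: "k \<ge> 1"
  shows "integrable (Leb k) (\<lambda>\<theta>. exp (- (c * sqnorm k \<theta>)) * (dot k \<theta> h) ^ 4)"
    and "(\<integral>\<theta>. exp (- (c * sqnorm k \<theta>)) * (dot k \<theta> h) ^ 4 \<partial>Leb k)
      \<le> 9 / 2 * (real k / c)\<^sup>2 * sqrt (pi / c) ^ k"
proof -
  define a where "a = sqrt (4 * c / k)"
  have a: "a\<^sup>2 = 4 * c / k" "a > 0" using c k by (auto simp: a_def)
  then have a4: "a ^ 4 = 16 * (c / k)\<^sup>2"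
    using power_mult[of a 2 2] by (simp add: power_divide power_mult_distrib)
  define F where "F \<theta> = 12 / a ^ 4 * (exp (- (c * sqnorm k \<theta>) + a * dot k \<theta> h)
    + exp (- (c * sqnorm k \<theta>) + (- a) * dot k \<theta> h))" for \<theta>
  define I where "I = 12 / a ^ 4 * (sqrt (pi / c) ^ k * exp (k * a\<^sup>2 / (4 * c))
    + sqrt (pi / c) ^ k * exp (k * (- a)\<^sup>2 / (4 * c)))"
  have F: "has_bochner_integral (Leb k) F I"
    unfolding F_def I_def
    by (intro has_bochner_integral_mult_right has_bochner_integral_add gaussian_product_mgf c h)
  have le: "exp (- (c * sqnorm k \<theta>)) * (dot k \<theta> h) ^ 4 \<le> F \<theta>" for \<theta>
  proof -
    have "(dot k \<theta> h) ^ 4 \<le> 12 / a ^ 4 * (exp (a * dot k \<theta> h) + exp (- (a * dot k \<theta> h)))"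
      using fourth_power_le_cosh[of "a * dot k \<theta> h"] a(2)
      by (simp add: power_mult_distrib field_simps)
    then have "exp (- (c * sqnorm k \<theta>)) * (dot k \<theta> h) ^ 4
        \<le> exp (- (c * sqnorm k \<theta>)) * (12 / a ^ 4 * (exp (a * dot k \<theta> h) + exp (- (a * dot k \<theta> h))))"
      by (intro mult_left_mono) auto
    also have "\<dots> = F \<theta>" unfolding F_def exp_add by (simp add: algebra_simps)
    finally show ?thesis .
  qed
  show int: "integrable (Leb k) (\<lambda>\<theta>. exp (- (c * sqnorm k \<theta>)) * (dot k \<theta> h) ^ 4)"
  proof (rule Bochner_Integration.integrable_bound)
    show "integrable (Leb k) F" using F by (rule integrable.intros)
    show "AE \<theta> in Leb k. norm (exp (- (c * sqnorm k \<theta>)) * (dot k \<theta> h) ^ 4) \<le> norm (F \<theta>)"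
      using le by (auto simp: abs_mult intro: order_trans[OF _ abs_ge_self])
  qed measurable
  have "(\<integral>\<theta>. exp (- (c * sqnorm k \<theta>)) * (dot k \<theta> h) ^ 4 \<partial>Leb k) \<le> (\<integral>\<theta>. F \<theta> \<partial>Leb k)"
    using F by (intro integral_mono int le) (rule integrable.intros)
  also have "\<dots> = I" using F by (rule has_bochner_integral_integral_eq)
  also have "\<dots> = 3 / 2 * exp 1 * (real k / c)\<^sup>2 * sqrt (pi / c) ^ k"
    using c k unfolding I_def a4 power2_minus a(1) by (simp add: power_divide field_simps)
  also have "\<dots> \<le> 3 / 2 * 3 * (real k / c)\<^sup>2 * sqrt (pi / c) ^ k"
    using exp_le c by (intro mult_right_mono mult_left_mono) auto
  finally show "(\<integral>\<theta>. exp (- (c * sqnorm k \<theta>)) * (dot k \<theta> h) ^ 4 \<partial>Leb k)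
      \<le> 9 / 2 * (real k / c)\<^sup>2 * sqrt (pi / c) ^ k" by simp
qed

section \<open>The cosine product near the origin\<close>

text \<open>
  This is \<open>|H\<^sup>T \<theta>|\<^sup>2 = s |\<theta>|\<^sup>2\<close>, from \<open>H H\<^sup>T = s I\<close>.
\<close>

lemma hadamard_sum_squares:
  assumes H: "H \<in> hadamards k s"
  shows "(\<Sum>j<s. (dot k \<theta> (H j))\<^sup>2) = s * sqnorm k \<theta>"
proof -
  have "(\<Sum>j<s. (dot k \<theta> (H j))\<^sup>2) = (\<Sum>i<k. \<Sum>l<k. \<theta> i * \<theta> l * (\<Sum>j<s. H j i * H j l))"
    unfolding dot_def power2_eq_square sum_product
    by (subst sum.swap, rule sum.cong[OF refl], subst sum.swap) (simp add: sum_distrib_left mult_ac)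
  also have "\<dots> = (\<Sum>i<k. \<Sum>l<k. if l = i then s * (\<theta> i)\<^sup>2 else 0)"
  proof (intro sum.cong refl)
    fix i l assume il: "i \<in> {..<k}" "l \<in> {..<k}"
    have "(\<Sum>j<s. H j i * H j l) = (if l = i then real s else 0)"
    proof (cases "l = i")
      case True
      then have "(\<Sum>j<s. H j i * H j l) = (\<Sum>j<s. 1)"
        using il by (intro sum.cong) (auto intro: signs_square sign_matrices_nth[OF hadamards_sign_matrices[OF H]])
      then show ?thesis using True by simp
    qed (use H il in \<open>auto simp: hadamards_def\<close>)
    then show "\<theta> i * \<theta> l * (\<Sum>j<s. H j i * H j l) = (if l = i then s * (\<theta> i)\<^sup>2 else 0)"
      by (simp add: power2_eq_square)
  qed
  also have "\<dots> = s * sqnorm k \<theta>" by (simp add: sqnorm_def sum_distrib_left)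
  finally show ?thesis .
qed

lemma dot_square_le:
  assumes "h \<in> signs k"
  shows "(dot k \<theta> h)\<^sup>2 \<le> k * sqnorm k \<theta>"
proof -
  have "(dot k \<theta> h)\<^sup>2 \<le> (\<Sum>i<k. (\<theta> i * h i)\<^sup>2) * card {..<k}"
    unfolding dot_def by (rule sum_squared_le_sum_of_squares)
  also have "(\<Sum>i<k. (\<theta> i * h i)\<^sup>2) = sqnorm k \<theta>"
    unfolding sqnorm_def using signs_square[OF assms]
    by (intro sum.cong) (auto simp: power2_eq_square power_mult_distrib)
  finally show ?thesis by (simp add: mult.commute)
qed

text \<open>
  With \<open>u = \<langle>\<theta>, h\<^sub>j\<rangle>\<close> each factor lies between \<open>exp (- u\<^sup>2/2 - u\<^sup>4/2)\<close> and \<open>exp (- u\<^sup>2/2)\<close> because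
  \<open>|u| \<le> 1\<close>, and the sum of the \<open>u\<^sup>2\<close> is known exactly for a partial Hadamard matrix.
\<close>

lemma cos_prod_core:
  assumes H: "H \<in> hadamards k s" and small: "k * sqnorm k \<theta> \<le> 1"
  shows "\<bar>cos_prod k s H \<theta> - exp (- (s / 2 * sqnorm k \<theta>))\<bar>
    \<le> exp (- (s / 2 * sqnorm k \<theta>)) * (\<Sum>j<s. (dot k \<theta> (H j)) ^ 4)"
proof -
  have u: "\<bar>dot k \<theta> (H j)\<bar> \<le> 1" if "j < s" for j
    using dot_square_le[OF sign_matrices_nth[OF hadamards_sign_matrices[OF H] that], of \<theta>] small
    by (simp flip: abs_square_le_1)
  have ss: "(\<Sum>j<s. - (dot k \<theta> (H j))\<^sup>2 / 2) = - (s / 2 * sqnorm k \<theta>)"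
    using hadamard_sum_squares[OF H, of \<theta>] by (simp add: sum_negf flip: sum_divide_distrib)
  define Q where "Q = (\<Sum>j<s. (dot k \<theta> (H j)) ^ 4)"
  have Q: "Q \<ge> 0" by (simp add: Q_def sum_nonneg)
  have "cos_prod k s H \<theta> \<le> (\<Prod>j<s. exp (- (dot k \<theta> (H j))\<^sup>2 / 2))"
    unfolding cos_prod_def
  proof (intro prod_mono conjI)
    fix j assume "j \<in> {..<s}"
    then have "\<bar>dot k \<theta> (H j)\<bar> \<le> 1" using u by simp
    then show "cos (dot k \<theta> (H j)) \<le> exp (- (dot k \<theta> (H j))\<^sup>2 / 2)" by (intro cos_le_exp) simp
    show "0 \<le> cos (dot k \<theta> (H j))" 
      using \<open>\<bar>dot k \<theta> (H j)\<bar> \<le> 1\<close> pi_gt3 by (intro cos_ge_zero) (auto simp: abs_le_iff)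
  qed
  also have "\<dots> = exp (- (s / 2 * sqnorm k \<theta>))" by (subst exp_sum[symmetric], simp, simp only: ss)
  finally have up: "cos_prod k s H \<theta> \<le> exp (- (s / 2 * sqnorm k \<theta>))" .
  have "exp (- (s / 2 * sqnorm k \<theta>)) * (1 - Q) \<le> exp (- (s / 2 * sqnorm k \<theta>)) * exp (- Q / 2)"
    using exp_ge_add_one_self[of "- Q / 2"] Q by (intro mult_left_mono) auto
  also have "\<dots> = exp (\<Sum>j<s. - (dot k \<theta> (H j))\<^sup>2 / 2 - (dot k \<theta> (H j)) ^ 4 / 2)"
    unfolding sum_subtractf ss by (simp add: Q_def flip: exp_add sum_divide_distrib)
  also have "\<dots> \<le> cos_prod k s H \<theta>"
    unfolding cos_prod_def exp_sum[OF finite_lessThan]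
    using u by (intro prod_mono conjI cos_ge_exp) auto
  finally show ?thesis using up Q by (simp add: Q_def[symmetric] algebra_simps)
qed

text \<open>
  The core \<open>k |\<theta>|\<^sup>2 \<le> 1/2\<close> lies inside the cube. The constant 1 instead of \<open>1/2\<close> would fail for \<open>k = 1\<close>, as
  \<open>\<pi>/4 < 1\<close>.
\<close>

lemma cube_off_core:
  assumes "cube k \<theta> \<noteq> 1" and "k \<ge> 1"
  shows "k * sqnorm k \<theta> > 1 / 2"
proof -
  obtain i where i: "i < k" "\<bar>\<theta> i\<bar> > pi / 4"
    using assms(1) by (auto simp: cube_cases split: if_splits)
  have "(3 / 4)\<^sup>2 \<le> \<bar>\<theta> i\<bar>\<^sup>2" using i pi_gt3 by (intro power_mono) auto
  also have "\<dots> \<le> sqnorm k \<theta>"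
    unfolding sqnorm_def power2_abs using i by (intro member_le_sum) auto
  also have "\<dots> = 1 * sqnorm k \<theta>" by simp
  also have "\<dots> \<le> k * sqnorm k \<theta>"
    using assms(2) by (intro mult_right_mono) (auto simp: sqnorm_def sum_nonneg)
  finally show ?thesis by (simp add: power2_eq_square)
qed

section \<open>The effect of one more row\<close>

lemma shifted_prod_abs:
  assumes H: "H \<in> hadamards k s" and k: "k \<ge> 1"
  shows "\<bar>shifted_prod k s H \<theta>\<bar> = (\<Prod>j<s. \<bar>sin (dot k \<theta> (H j))\<bar>)"
  unfolding shifted_prod_def abs_prod
proof (intro prod.cong refl)
  fix j assume "j \<in> {..<s}"
  then have "H j 0 = 1 \<or> H j 0 = -1"
    using signs_cases[OF sign_matrices_nth[OF hadamards_sign_matrices[OF H]], of j 0] k by simp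
  then show "\<bar>cos (dot k \<theta> (H j) + H j 0 * (pi / 2))\<bar> = \<bar>sin (dot k \<theta> (H j))\<bar>"
    by (elim disjE) (simp_all add: cos_add cos_diff)
qed

lemma sum_shifted_integral_le:
  assumes k: "k \<ge> 1"
  shows "(\<Sum>H\<in>hadamards k s. \<bar>\<integral>\<theta>. cube k \<theta> * shifted_prod k s H \<theta> \<partial>Leb k\<bar>)
    \<le> (pi / 2) ^ k * (2 ^ (k * s) * exp (- real s / 24))"
proof -
  have int: "integrable (Leb k) (\<lambda>\<theta>. cube k \<theta> * \<bar>shifted_prod k s H \<theta>\<bar>)" for H
    using integrable_cube_mult[of "\<lambda>\<theta>. \<bar>shifted_prod k s H \<theta>\<bar>" k 1]
    by (simp add: shifted_prod_def abs_prod prod_le_1)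
  have "(\<Sum>H\<in>hadamards k s. \<bar>\<integral>\<theta>. cube k \<theta> * shifted_prod k s H \<theta> \<partial>Leb k\<bar>)
      \<le> (\<Sum>H\<in>hadamards k s. \<integral>\<theta>. cube k \<theta> * \<bar>shifted_prod k s H \<theta>\<bar> \<partial>Leb k)"
  proof (rule sum_mono)
    fix H
    have "\<bar>\<integral>\<theta>. cube k \<theta> * shifted_prod k s H \<theta> \<partial>Leb k\<bar>
        \<le> (\<integral>\<theta>. \<bar>cube k \<theta> * shifted_prod k s H \<theta>\<bar> \<partial>Leb k)" by (rule integral_abs_bound)
    then show "\<bar>\<integral>\<theta>. cube k \<theta> * shifted_prod k s H \<theta> \<partial>Leb k\<bar>
        \<le> (\<integral>\<theta>. cube k \<theta> * \<bar>shifted_prod k s H \<theta>\<bar> \<partial>Leb k)"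
      by (simp add: abs_mult cube_cases cong: if_cong)
  qed
  also have "\<dots> = (\<integral>\<theta>. (\<Sum>H\<in>hadamards k s. cube k \<theta> * \<bar>shifted_prod k s H \<theta>\<bar>) \<partial>Leb k)"
    by (rule Bochner_Integration.integral_sum[symmetric]) (rule int)
  also have "\<dots> \<le> (\<integral>\<theta>. cube k \<theta> * (2 ^ (k * s) * exp (- real s / 24)) \<partial>Leb k)"
  proof (intro integral_mono Bochner_Integration.integrable_sum int)
    show "integrable (Leb k) (\<lambda>\<theta>. cube k \<theta> * (2 ^ (k * s) * exp (- real s / 24)))"
      using integrable_cube by simp
    fix \<theta>
    have "(\<Sum>H\<in>hadamards k s. cube k \<theta> * \<bar>shifted_prod k s H \<theta>\<bar>)
        = cube k \<theta> * (\<Sum>H\<in>hadamards k s. \<Prod>j<s. \<bar>sin (dot k \<theta> (H j))\<bar>)"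
      using k by (simp add: sum_distrib_left shifted_prod_abs)
    also have "\<dots> \<le> cube k \<theta> * (2 ^ (k * s) * exp (- real s / 24))"
      using sum_hadamards_sin_le[of k \<theta> s] by (simp add: cube_cases)
    finally show "(\<Sum>H\<in>hadamards k s. cube k \<theta> * \<bar>shifted_prod k s H \<theta>\<bar>)
        \<le> cube k \<theta> * (2 ^ (k * s) * exp (- real s / 24))" .
  qed
  also have "\<dots> = (pi / 2) ^ k * (2 ^ (k * s) * exp (- real s / 24))"
    by (simp add: integral_cube)
  finally show ?thesis .
qed

text \<open>
  On the core the first term on the right comes from the Gaussian approximation. Off the core the cosine product
  and the Gaussian are both bounded by \<open>exp (- s |\<theta>|\<^sup>2 / 8)\<close>, up to the exceptional term; half of this exponent
  is spent on the small constant factor and the other half is kept to make the bound integrable.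
\<close>

lemma sum_cos_prod_pointwise:
  fixes k s :: nat
  assumes k: "k \<ge> 1"
  defines "N \<equiv> real (card (hadamards k s))"
  shows "(\<Sum>H\<in>hadamards k s. \<bar>cube k \<theta> * cos_prod k s H \<theta> - exp (- (s / 2 * sqnorm k \<theta>))\<bar>)
    \<le> (\<Sum>H\<in>hadamards k s. \<Sum>j<s. exp (- (s / 2 * sqnorm k \<theta>)) * (dot k \<theta> (H j)) ^ 4)
      + 2 * N * exp (- (s / (32 * k))) * exp (- (s / 16 * sqnorm k \<theta>))
      + cube k \<theta> * (2 ^ (k * s) * exp (- real s / 24))" (is "?L \<le> ?A + ?B + ?C")
proof (cases "k * sqnorm k \<theta> \<le> 1 / 2")
  case True
  then have b: "cube k \<theta> = 1" using cube_off_core[of k \<theta>] k by force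
  have "?L \<le> (\<Sum>H\<in>hadamards k s. exp (- (s / 2 * sqnorm k \<theta>)) * (\<Sum>j<s. (dot k \<theta> (H j)) ^ 4))"
  proof (rule sum_mono)
    fix H assume "H \<in> hadamards k s"
    from cos_prod_core[OF this, of \<theta>] True
    show "\<bar>cube k \<theta> * cos_prod k s H \<theta> - exp (- (s / 2 * sqnorm k \<theta>))\<bar>
        \<le> exp (- (s / 2 * sqnorm k \<theta>)) * (\<Sum>j<s. (dot k \<theta> (H j)) ^ 4)" by (simp add: b)
  qed
  also have "\<dots> = ?A" by (simp add: sum_distrib_left)
  finally show ?thesis by (simp add: b N_def add_increasing2)
next
  case False
  then have "s / 16 * (1 / (2 * k)) \<le> s / 16 * sqnorm k \<theta>"
    using k by (intro mult_left_mono) (auto simp: field_simps)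
  then have e: "exp (- (s / 8 * sqnorm k \<theta>)) \<le> exp (- (s / (32 * k))) * exp (- (s / 16 * sqnorm k \<theta>))"
    by (simp flip: exp_add)
  have sq: "sqnorm k \<theta> \<ge> 0" by (simp add: sqnorm_def sum_nonneg)
  have "?L \<le> (\<Sum>H\<in>hadamards k s. cube k \<theta> * \<bar>cos_prod k s H \<theta>\<bar> + exp (- (s / 2 * sqnorm k \<theta>)))"
  proof (rule sum_mono)
    fix H
    have "\<bar>cube k \<theta>\<bar> = cube k \<theta>" by (simp add: cube_cases)
    then show "\<bar>cube k \<theta> * cos_prod k s H \<theta> - exp (- (s / 2 * sqnorm k \<theta>))\<bar>
        \<le> cube k \<theta> * \<bar>cos_prod k s H \<theta>\<bar> + exp (- (s / 2 * sqnorm k \<theta>))"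
      using abs_triangle_ineq4[of "cube k \<theta> * cos_prod k s H \<theta>" "exp (- (s / 2 * sqnorm k \<theta>))"]
      by (simp only: abs_mult abs_exp_cancel)
  qed
  also have "\<dots> = cube k \<theta> * (\<Sum>H\<in>hadamards k s. \<bar>cos_prod k s H \<theta>\<bar>) + N * exp (- (s / 2 * sqnorm k \<theta>))"
    by (simp add: sum.distrib sum_distrib_left N_def)
  also have "cube k \<theta> * (\<Sum>H\<in>hadamards k s. \<bar>cos_prod k s H \<theta>\<bar>)
      \<le> cube k \<theta> * (N * exp (- (s / 8 * sqnorm k \<theta>)) + 2 ^ (k * s) * exp (- real s / 24))"
    using sum_hadamards_cos_le[of k \<theta> s] by (simp add: cube_cases cos_prod_def abs_prod N_def)
  also have "\<dots> \<le> N * exp (- (s / 8 * sqnorm k \<theta>)) + ?C"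
    by (simp add: cube_cases N_def)
  also have "N * exp (- (s / 2 * sqnorm k \<theta>)) \<le> N * exp (- (s / 8 * sqnorm k \<theta>))"
    using sq by (intro mult_left_mono) (auto simp: N_def intro!: mult_right_mono)
  also have "N * exp (- (s / 8 * sqnorm k \<theta>)) + ?C + N * exp (- (s / 8 * sqnorm k \<theta>))
      = 2 * N * exp (- (s / 8 * sqnorm k \<theta>)) + ?C" by simp
  also have "2 * N * exp (- (s / 8 * sqnorm k \<theta>)) \<le> ?B"
    using mult_left_mono[OF e, of "2 * N"] by (simp add: N_def mult.assoc)
  finally have "?L \<le> ?B + ?C" by simp
  moreover have "0 \<le> ?A" by (intro sum_nonneg) auto
  ultimately show ?thesis by linarith
qed

lemma sum_cos_prod_integral:
  fixes k s :: nat
  assumes k: "k \<ge> 1" and s: "s \<ge> 1"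
  defines "N \<equiv> real (card (hadamards k s))" and "G \<equiv> sqrt (2 * pi / s) ^ k"
  shows "(\<Sum>H\<in>hadamards k s. \<bar>(\<integral>\<theta>. cube k \<theta> * cos_prod k s H \<theta> \<partial>Leb k) - G\<bar>)
    \<le> N * G * (18 * (real k)\<^sup>2 / s + 2 * exp (- (s / (32 * k))) * sqrt 8 ^ k)
      + (pi / 2) ^ k * (2 ^ (k * s) * exp (- real s / 24))"
proof -
  let ?g = "\<lambda>\<theta>. exp (- (s / 2 * sqnorm k \<theta>))"
  have gi: "has_bochner_integral (Leb k) ?g G"
    using gaussian_integral[of "s / 2" k] s by (simp add: G_def mult.commute)
  then have gint: "integrable (Leb k) ?g" by (rule integrable.intros)
  have hi: "has_bochner_integral (Leb k) (\<lambda>\<theta>. exp (- (s / 16 * sqnorm k \<theta>))) (sqrt 8 ^ k * G)"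
  proof -
    have "sqrt (pi / (real s / 16)) = sqrt 8 * sqrt (2 * pi / s)"
      by (simp flip: real_sqrt_mult)
    then show ?thesis
      using gaussian_integral[of "s / 16" k] s by (simp add: G_def power_mult_distrib)
  qed
  have dint: "integrable (Leb k) (\<lambda>\<theta>. \<bar>cube k \<theta> * cos_prod k s H \<theta> - ?g \<theta>\<bar>)" for H
    by (intro integrable_abs Bochner_Integration.integrable_diff integrable_cube_cos_prod gint)
  have sg: "H j \<in> signs k" if "H \<in> hadamards k s" "j \<in> {..<s}" for H j
    using that by (auto intro: sign_matrices_nth[OF hadamards_sign_matrices])
  have mint: "integrable (Leb k) (\<lambda>\<theta>. ?g \<theta> * (dot k \<theta> (H j)) ^ 4)"
    and mle: "(\<integral>\<theta>. ?g \<theta> * (dot k \<theta> (H j)) ^ 4 \<partial>Leb k) \<le> 18 * (real k)\<^sup>2 / (real s)\<^sup>2 * G"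
    if "H \<in> hadamards k s" "j \<in> {..<s}" for H j
    using gaussian_fourth_moment[OF _ sg[OF that] k, of "s / 2"] s
    by (simp_all add: G_def power_divide power_mult_distrib mult.commute)
  define A B C where "A \<theta> = (\<Sum>H\<in>hadamards k s. \<Sum>j<s. ?g \<theta> * (dot k \<theta> (H j)) ^ 4)"
    and "B \<theta> = 2 * N * exp (- (s / (32 * k))) * exp (- (s / 16 * sqnorm k \<theta>))"
    and "C \<theta> = cube k \<theta> * (2 ^ (k * s) * exp (- real s / 24))" for \<theta>
  have A: "integrable (Leb k) A" "(\<integral>\<theta>. A \<theta> \<partial>Leb k) \<le> N * G * (18 * (real k)\<^sup>2 / s)"
  proof -
    show "integrable (Leb k) A"
      unfolding A_def by (intro Bochner_Integration.integrable_sum mint)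
    have "(\<integral>\<theta>. A \<theta> \<partial>Leb k) = (\<Sum>H\<in>hadamards k s. \<integral>\<theta>. (\<Sum>j<s. ?g \<theta> * (dot k \<theta> (H j)) ^ 4) \<partial>Leb k)"
      unfolding A_def by (intro Bochner_Integration.integral_sum Bochner_Integration.integrable_sum mint)
    also have "\<dots> = (\<Sum>H\<in>hadamards k s. \<Sum>j<s. \<integral>\<theta>. ?g \<theta> * (dot k \<theta> (H j)) ^ 4 \<partial>Leb k)"
      by (intro sum.cong refl Bochner_Integration.integral_sum mint)
    also have "\<dots> \<le> (\<Sum>H\<in>hadamards k s. \<Sum>j<s. 18 * (real k)\<^sup>2 / (real s)\<^sup>2 * G)"
      by (intro sum_mono mle)
    also have "\<dots> = N * G * (18 * (real k)\<^sup>2 / s)"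
      using s by (simp add: N_def power2_eq_square)
    finally show "(\<integral>\<theta>. A \<theta> \<partial>Leb k) \<le> N * G * (18 * (real k)\<^sup>2 / s)" .
  qed
  have B: "has_bochner_integral (Leb k) B (2 * N * exp (- (s / (32 * k))) * (sqrt 8 ^ k * G))"
    unfolding B_def by (intro has_bochner_integral_mult_right hi)
  have C: "integrable (Leb k) C" "(\<integral>\<theta>. C \<theta> \<partial>Leb k) = (pi / 2) ^ k * (2 ^ (k * s) * exp (- real s / 24))"
    unfolding C_def using integrable_cube by (simp_all add: integral_cube)
  have Bi: "integrable (Leb k) B" and Bv: "(\<integral>\<theta>. B \<theta> \<partial>Leb k) = 2 * N * exp (- (s / (32 * k))) * (sqrt 8 ^ k * G)"
    using B by (auto simp: has_bochner_integral_iff)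
  have "(\<Sum>H\<in>hadamards k s. \<bar>(\<integral>\<theta>. cube k \<theta> * cos_prod k s H \<theta> \<partial>Leb k) - G\<bar>)
      \<le> (\<Sum>H\<in>hadamards k s. \<integral>\<theta>. \<bar>cube k \<theta> * cos_prod k s H \<theta> - ?g \<theta>\<bar> \<partial>Leb k)"
  proof (rule sum_mono)
    fix H
    have "(\<integral>\<theta>. cube k \<theta> * cos_prod k s H \<theta> \<partial>Leb k) - G
        = (\<integral>\<theta>. cube k \<theta> * cos_prod k s H \<theta> - ?g \<theta> \<partial>Leb k)"
      using gi by (subst Bochner_Integration.integral_diff[OF integrable_cube_cos_prod gint])
        (simp add: has_bochner_integral_integral_eq)
    then show "\<bar>(\<integral>\<theta>. cube k \<theta> * cos_prod k s H \<theta> \<partial>Leb k) - G\<bar>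
        \<le> (\<integral>\<theta>. \<bar>cube k \<theta> * cos_prod k s H \<theta> - ?g \<theta>\<bar> \<partial>Leb k)"
      by (simp add: integral_abs_bound)
  qed
  also have "\<dots> = (\<integral>\<theta>. (\<Sum>H\<in>hadamards k s. \<bar>cube k \<theta> * cos_prod k s H \<theta> - ?g \<theta>\<bar>) \<partial>Leb k)"
    by (rule Bochner_Integration.integral_sum[symmetric]) (rule dint)
  also have "\<dots> \<le> (\<integral>\<theta>. A \<theta> + B \<theta> + C \<theta> \<partial>Leb k)"
  proof (rule integral_mono)
    show "integrable (Leb k) (\<lambda>\<theta>. \<Sum>H\<in>hadamards k s. \<bar>cube k \<theta> * cos_prod k s H \<theta> - ?g \<theta>\<bar>)"
      by (intro Bochner_Integration.integrable_sum dint)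
    show "integrable (Leb k) (\<lambda>\<theta>. A \<theta> + B \<theta> + C \<theta>)"
      by (intro Bochner_Integration.integrable_add A Bi C)
    show "(\<Sum>H\<in>hadamards k s. \<bar>cube k \<theta> * cos_prod k s H \<theta> - ?g \<theta>\<bar>) \<le> A \<theta> + B \<theta> + C \<theta>" for \<theta>
      unfolding A_def B_def C_def N_def by (rule sum_cos_prod_pointwise[OF k])
  qed
  also have "\<dots> = (\<integral>\<theta>. A \<theta> \<partial>Leb k) + (\<integral>\<theta>. B \<theta> \<partial>Leb k) + (\<integral>\<theta>. C \<theta> \<partial>Leb k)"
    using A(1) Bi C(1) by (simp add: Bochner_Integration.integral_add)
  also have "\<dots> \<le> N * G * (18 * (real k)\<^sup>2 / s) + (2 * N * exp (- (s / (32 * k))) * (sqrt 8 ^ k * G))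
      + (pi / 2) ^ k * (2 ^ (k * s) * exp (- real s / 24))"
    unfolding Bv C(2) using A(2) by simp
  finally show ?thesis by (simp add: algebra_simps)
qed

definition hadamard_prob :: "nat \<Rightarrow> nat \<Rightarrow> real" where
  "hadamard_prob k s = card (hadamards k s) / 2 ^ (k * s)"

definition row_prob :: "nat \<Rightarrow> nat \<Rightarrow> real" where
  "row_prob k s = (2 / pi) ^ k * sqrt (2 * pi / s) ^ k / 2"

text \<open>
  The last summand collects two exponentially small contributions, one from the cosine product away from the core
  and one from the shifted product; the volume of the cube cancels against the normalisation of the Fourier integral.
\<close>

lemma hadamard_prob_Suc:
  fixes k t :: nat
  defines "s \<equiv> 4 * t"
  assumes k: "k \<ge> 1" and t: "t \<ge> 1"
  shows "\<bar>hadamard_prob (Suc k) s - row_prob k s * hadamard_prob k s\<bar>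
    \<le> row_prob k s * hadamard_prob k s * (18 * (real k)\<^sup>2 / s + 2 * exp (- (s / (32 * k))) * sqrt 8 ^ k)
      + exp (- real s / 24)"
proof -
  define N where "N = real (card (hadamards k s))"
  define G where "G = sqrt (2 * pi / s) ^ k"
  define E where "E = 18 * (real k)\<^sup>2 / s + 2 * exp (- (s / (32 * k))) * sqrt 8 ^ k"
  define P where "P = (pi / 2) ^ k"
  define W where "W = P * (2 ^ (k * s) * exp (- real s / 24))"
  define X where "X H = (\<integral>\<theta>. cube k \<theta> * cos_prod k s H \<theta> \<partial>Leb k)" for H
  define Y where "Y H = (\<integral>\<theta>. cube k \<theta> * shifted_prod k s H \<theta> \<partial>Leb k)" for H
  have s: "s \<ge> 1" using t by (simp add: s_def)
  have P: "P > 0" by (simp add: P_def)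
  have row: "real (card (orth_signs k s H)) * P = 2 ^ s / 2 * (X H + Y H)" if "H \<in> hadamards k s" for H
  proof -
    have "(\<integral>\<theta>. cube k \<theta> * ((cos_prod k s H \<theta> + shifted_prod k s H \<theta>) / 2) \<partial>Leb k)
        = (\<integral>\<theta>. (cube k \<theta> * cos_prod k s H \<theta> + cube k \<theta> * shifted_prod k s H \<theta>) / 2 \<partial>Leb k)"
      by (simp add: distrib_left)
    also have "\<dots> = (X H + Y H) / 2"
      unfolding X_def Y_def
      by (simp add: Bochner_Integration.integral_add integrable_cube_cos_prod integrable_cube_shifted_prod)
    finally show ?thesis
      using card_orth_signs_integral[OF that[unfolded s_def] k] by (simp add: s_def P_def)
  qed
  have "real (card (hadamards (Suc k) s)) * P = (\<Sum>H\<in>hadamards k s. 2 ^ s / 2 * (X H + Y H))"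
    unfolding card_hadamards_Suc of_nat_sum sum_distrib_right by (intro sum.cong refl row)
  also have "\<dots> = 2 ^ s / 2 * (\<Sum>H\<in>hadamards k s. X H + Y H)" by (rule sum_distrib_left[symmetric])
  finally have eq: "real (card (hadamards (Suc k) s)) * P - 2 ^ s / 2 * (N * G)
      = 2 ^ s / 2 * (\<Sum>H\<in>hadamards k s. (X H - G) + Y H)"
    by (simp add: N_def sum.distrib sum_subtractf algebra_simps)
  have "\<bar>\<Sum>H\<in>hadamards k s. (X H - G) + Y H\<bar> \<le> (\<Sum>H\<in>hadamards k s. \<bar>X H - G\<bar> + \<bar>Y H\<bar>)"
    by (rule order_trans[OF sum_abs sum_mono]) (rule abs_triangle_ineq)
  also have "\<dots> = (\<Sum>H\<in>hadamards k s. \<bar>X H - G\<bar>) + (\<Sum>H\<in>hadamards k s. \<bar>Y H\<bar>)" by (rule sum.distrib)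
  also have "\<dots> \<le> (N * G * E + W) + W"
    unfolding X_def Y_def N_def G_def E_def W_def P_def
    by (intro add_mono sum_cos_prod_integral sum_shifted_integral_le k s)
  finally have "\<bar>real (card (hadamards (Suc k) s)) * P - 2 ^ s / 2 * (N * G)\<bar> \<le> 2 ^ s / 2 * (N * G * E + 2 * W)"
    unfolding eq abs_mult by simp
  then have le: "\<bar>real (card (hadamards (Suc k) s)) * P - 2 ^ s / 2 * (N * G)\<bar> / (2 ^ (Suc k * s) * P)
      \<le> 2 ^ s / 2 * (N * G * E + 2 * W) / (2 ^ (Suc k * s) * P)"
    using P by (intro divide_right_mono) auto
  have q: "row_prob k s = G / P / 2"
    by (simp add: row_prob_def G_def P_def power_divide)
  have "\<bar>real (card (hadamards (Suc k) s)) * P - 2 ^ s / 2 * (N * G)\<bar> / (2 ^ (Suc k * s) * P)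
      = \<bar>(real (card (hadamards (Suc k) s)) * P - 2 ^ s / 2 * (N * G)) / (2 ^ (Suc k * s) * P)\<bar>"
    using P by (simp add: abs_divide abs_mult)
  moreover have "(real (card (hadamards (Suc k) s)) * P - 2 ^ s / 2 * (N * G)) / (2 ^ (Suc k * s) * P)
      = hadamard_prob (Suc k) s - row_prob k s * hadamard_prob k s"
    using P by (simp add: hadamard_prob_def q N_def power_add field_simps)
  moreover have "2 ^ s / 2 * (N * G * E + 2 * W) / (2 ^ (Suc k * s) * P)
      = row_prob k s * hadamard_prob k s * E + exp (- real s / 24)"
    using P by (simp add: hadamard_prob_def q N_def W_def power_add field_simps)
  ultimately show ?thesis using le by (simp only: E_def)
qed

section \<open>The product of the row probabilities\<close>

lemma row_prob_eq:
  assumes "s \<ge> 1"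
  shows "row_prob k s = (4 / sqrt (2 * pi * s)) ^ k / 2"
proof -
  have "2 / pi * sqrt (2 * pi / s) = sqrt ((2 / pi)\<^sup>2 * (2 * pi / s))"
  proof -
    have "sqrt ((2 / pi)\<^sup>2) = 2 / pi" by simp
    then show ?thesis by (simp only: real_sqrt_mult)
  qed
  also have "(2 / pi)\<^sup>2 * (2 * pi / s) = 4\<^sup>2 / (2 * pi * s)"
    by (simp add: power2_eq_square field_simps)
  also have "sqrt (4\<^sup>2 / (2 * pi * s)) = 4 / sqrt (2 * pi * s)"
    by (simp only: real_sqrt_divide real_sqrt_abs)
  finally show ?thesis by (simp add: row_prob_def flip: power_mult_distrib)
qed

lemma hadamard_asymp_eq_prod:
  assumes s: "s \<ge> 1" and n: "n \<ge> 1"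
  shows "hadamard_asymp n s = 2 ^ (n * s) * (\<Prod>i\<in>{1..<n}. row_prob i s)"
  using n
proof (induction n rule: nat_induct_at_least)
  case base
  then show ?case using s by (simp add: hadamard_asymp_def Let_def powr_realpow numeral_2_eq_2)
next
  case (Suc n)
  define d where "d = real (n choose 2)"
  have d: "real (Suc n choose 2) = d + n" by (simp add: d_def numeral_2_eq_2)
  have L: "2 * pi * real s > 0" using s by simp
  have "hadamard_asymp (Suc n) s
      = 2 powr ((real n * real s + 2 * d - real n + 1) + (real s + (2 * real n - 1)))
        * (2 * pi * real s) powr (- d / 2 + (- (real n / 2)))"
    unfolding hadamard_asymp_def d Let_def by (simp add: algebra_simps add_divide_distrib diff_divide_distrib)
  also have "\<dots> = hadamard_asymp n s * (2 powr real s * (2 powr (2 * real n - 1) * (2 * pi * real s) powr (- (real n / 2))))"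
    unfolding powr_add hadamard_asymp_def Let_def d_def by (simp add: mult_ac)
  also have "2 powr (2 * real n - 1) = 4 ^ n / 2"
    using powr_realpow[of 2 "2 * n"] by (simp add: powr_diff power_mult)
  also have "(2 * pi * real s) powr (- (real n / 2)) = (1 / sqrt (2 * pi * s)) ^ n"
  proof -
    have "(2 * pi * real s) powr (- (real n / 2)) = inverse (((2 * pi * real s) powr (1 / 2)) powr real n)"
      by (simp add: powr_minus powr_powr)
    also have "\<dots> = (1 / sqrt (2 * pi * s)) ^ n"
      using L by (simp add: powr_half_sqrt powr_realpow inverse_eq_divide power_divide)
    finally show ?thesis .
  qed
  also have "4 ^ n / 2 * (1 / sqrt (2 * pi * s)) ^ n = row_prob n s"
    by (simp add: row_prob_eq[OF s] power_divide)
  also have "2 powr real s = 2 ^ s" by (simp add: powr_realpow)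
  finally show ?case using Suc by (simp add: power_add prod.atLeastLessThan_Suc algebra_simps)
qed

lemma row_prob_ge:
  assumes "s \<ge> 1" "k \<ge> 1"
  shows "row_prob k s \<ge> (1 / sqrt (2 * pi * s)) ^ k"
proof -
  have "(4::real) ^ 1 \<le> 4 ^ k" using assms by (intro power_increasing) auto
  then have "1 * (1 / sqrt (2 * pi * s)) ^ k \<le> 4 ^ k / 2 * (1 / sqrt (2 * pi * s)) ^ k"
    by (intro mult_right_mono) auto
  then show ?thesis by (simp add: row_prob_eq[OF assms(1)] power_divide)
qed

text \<open>
  A crude lower bound, losing a factor 2 in the exponent \<open>n\<^sup>2\<close>; it only has to beat \<open>exp (- s / 24)\<close>.
\<close>

lemma prod_row_prob_ge:
  assumes s: "s \<ge> 1" and m: "m \<le> n"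
  shows "(\<Prod>i\<in>{1..<m}. row_prob i s) \<ge> (1 / sqrt (2 * pi * s)) ^ (n\<^sup>2)"
proof -
  define l where "l = 1 / sqrt (2 * pi * s)"
  have "1 \<le> 2 * pi * real s" using s pi_gt3 mult_mono[of 1 "2 * pi" 1 "real s"] by simp
  then have l: "0 \<le> l" "l \<le> 1" by (auto simp: l_def)
  have "l ^ (n\<^sup>2) \<le> l ^ (n * card {1..<m})"
    using m l by (intro power_decreasing) (auto simp: power2_eq_square)
  also have "\<dots> = (\<Prod>i\<in>{1..<m}. l ^ n)" by (simp add: power_mult)
  also have "\<dots> \<le> (\<Prod>i\<in>{1..<m}. row_prob i s)"
  proof (intro prod_mono conjI)
    fix i assume i: "i \<in> {1..<m}"
    have "l ^ n \<le> l ^ i" using i m l by (intro power_decreasing) auto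
    also have "\<dots> \<le> row_prob i s" using row_prob_ge[OF s, of i] i by (simp add: l_def)
    finally show "l ^ n \<le> row_prob i s" .
  qed (use l in auto)
  finally show ?thesis by (simp add: l_def)
qed

section \<open>Error estimates for s at least 4000 times the cube of n\<close>

lemma exp_neg_le_inverse: "x > 0 \<Longrightarrow> exp (- x) \<le> 1 / (x::real)"
proof -
  assume "x > 0"
  moreover have "x \<le> exp x" using exp_ge_add_one_self[of x] by linarith
  ultimately show "exp (- x) \<le> 1 / x" by (simp add: exp_minus field_simps)
qed

text \<open>
  In terms of \<open>z = s\<^sup>1\<^sup>/\<^sup>3\<close> the hypothesis gives \<open>n \<le> z / 15\<close>, while \<open>log (2 \<pi> s) \<le> 5 z\<close>; so
  \<open>n\<^sup>2 log s\<close> is at most a small multiple of \<open>z\<^sup>3 = s\<close>.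
\<close>

lemma exceptional_term_small:
  fixes n s :: nat
  assumes n: "n \<ge> 2" and s: "4000 * real n ^ 3 \<le> s"
  shows "exp (- real s / 24) * sqrt (2 * pi * s) ^ (n\<^sup>2) \<le> 1 / s"
proof -
  define z where "z = root 3 s"
  have z3: "z ^ 3 = s" and z0: "z \<ge> 0" by (simp_all add: z_def)
  have "(15 * real n) ^ 3 \<le> z ^ 3" using s by (simp add: z3 power_mult_distrib)
  then have zn: "15 * real n \<le> z" by (rule power_le_imp_le_base[of _ 2, simplified, folded numeral_3_eq_3]) (rule z0)
  with n have z: "z \<ge> 30" by simp
  then have s0: "real s > 0" using z3 zero_less_power[of z 3] by simp
  then have "real s \<ge> 1" by simp
  then have one: "1 \<le> 2 * pi * real s" using pi_gt3 mult_mono[of 1 "2 * pi" 1 "real s"] by simp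
  have lnz: "ln z \<le> z" using ln_le_minus_one[of z] z by simp
  have lns: "ln (real s) \<le> 3 * z"
    using lnz z by (simp add: z3[symmetric] ln_realpow)
  have "ln (2 * pi * real s) = ln (2 * pi) + ln (real s)" using s0 by (simp add: ln_mult)
  also have "ln (2 * pi) \<le> 2 * pi - 1" by (rule ln_le_minus_one) simp
  finally have lnps: "ln (2 * pi * real s) \<le> 5 * z" using lns z pi_less_4 by simp
  have "(real n)\<^sup>2 \<le> (z / 15)\<^sup>2" using zn by (intro power_mono) auto
  then have "(real n)\<^sup>2 * (ln (2 * pi * real s) / 2) \<le> (z / 15)\<^sup>2 * (5 * z / 2)"
    using lnps z ln_ge_zero[OF one] by (intro mult_mono) auto
  also have "\<dots> = real s / 90" by (simp add: z3[symmetric] power2_eq_square power3_eq_cube)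
  finally have 1: "(real n)\<^sup>2 * (ln (2 * pi * real s) / 2) \<le> real s / 90" .
  have "30\<^sup>2 \<le> z\<^sup>2" using z by (intro power_mono) auto
  then have "900 * z \<le> z\<^sup>2 * z" using z by (intro mult_right_mono) auto
  then have 2: "ln (real s) \<le> real s / 300" using lns by (simp add: z3[symmetric] power2_eq_square power3_eq_cube)
  have "sqrt (2 * pi * s) ^ (n\<^sup>2) = exp ((real n)\<^sup>2 * (ln (2 * pi * real s) / 2))"
  proof -
    have "sqrt (2 * pi * s) = exp (ln (2 * pi * real s) / 2)"
      using s0 by (simp flip: ln_sqrt)
    then show ?thesis by (simp flip: exp_of_nat_mult)
  qed
  then have "exp (- real s / 24) * sqrt (2 * pi * s) ^ (n\<^sup>2)
      = exp (- real s / 24 + (real n)\<^sup>2 * (ln (2 * pi * real s) / 2))" by (simp flip: exp_add)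
  also have "\<dots> \<le> exp (- ln (real s))" using 1 2 s0 by simp
  also have "\<dots> = 1 / s" using s0 by (simp add: exp_minus inverse_eq_divide)
  finally show ?thesis .
qed

text \<open>
  The exponential decay \<open>exp (- s / (32 k))\<close> absorbs \<open>8\<^sup>k\<^sup>/\<^sup>2\<close> because \<open>s / k\<close> is at least a large multiple of \<open>k\<^sup>2\<close>;
  what is left is compared with \<open>k / s\<close>.
\<close>

lemma row_error_small:
  fixes k n s :: nat
  assumes k: "k \<ge> 1" "k \<le> n" and s: "4000 * real n ^ 3 \<le> s"
  shows "18 * (real k)\<^sup>2 / s + 2 * exp (- (s / (32 * k))) * sqrt 8 ^ k \<le> 146 * (real k)\<^sup>2 / s"
proof -
  have "4000 * real k ^ 3 \<le> 4000 * real n ^ 3" using k by (intro mult_left_mono power_mono) auto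
  with s have sk: "4000 * real k ^ 3 \<le> s" by linarith
  have k1: "real k \<ge> 1" using k by simp
  have s0: "real s > 0" using sk k1 zero_less_power[of "real k" 3] by linarith
  have "sqrt 8 \<le> sqrt (3\<^sup>2)" by (intro real_sqrt_le_mono) simp
  also have "\<dots> = 3" by simp
  also have "\<dots> \<le> exp 2" using exp_ge_add_one_self[of 2] by simp
  finally have "sqrt 8 ^ k \<le> exp 2 ^ k" by (intro power_mono) auto
  also have "\<dots> = exp (2 * real k)" by (simp add: mult.commute flip: exp_of_nat_mult)
  finally have "exp (- (s / (32 * k))) * sqrt 8 ^ k \<le> exp (- (s / (32 * k))) * exp (2 * real k)"
    by (intro mult_left_mono) auto
  also have "\<dots> \<le> exp (- (s / (64 * k)))"
  proof -
    have "(real k)\<^sup>2 * 1 \<le> (real k)\<^sup>2 * real k" using k1 by (intro mult_left_mono) auto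
    then have "128 * (real k)\<^sup>2 \<le> s"
      using sk by (simp add: power2_eq_square power3_eq_cube)
    then have "2 * real k \<le> s / (64 * k)" using k1 by (simp add: field_simps power2_eq_square)
    then show ?thesis by (simp flip: exp_add)
  qed
  also have "\<dots> \<le> 1 / (s / (64 * k))" using s0 k1 by (intro exp_neg_le_inverse) auto
  also have "\<dots> = 64 * real k / s" by simp
  also have "\<dots> \<le> 64 * (real k)\<^sup>2 / s"
    using k1 s0 by (intro divide_right_mono) (auto simp: power2_eq_square)
  finally show ?thesis by (simp add: mult.assoc add_divide_distrib[symmetric])
qed

text \<open>
  The error telescopes: each row contributes at most \<open>(219 k\<^sup>2 + 1) / s\<close>, which is below
  \<open>220 ((k+1)\<^sup>3 - k\<^sup>3) / s\<close>. The accumulated error stays below \<open>1/2\<close>, and so the relative error of each row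
  is also an absolute error, up to the factor \<open>3/2\<close>.
\<close>

lemma hadamard_prob_ratio:
  fixes n t :: nat
  defines "s \<equiv> 4 * t"
  assumes n: "n \<ge> 2" and s: "4000 * real n ^ 3 \<le> s" and m: "1 \<le> m" "m \<le> n"
  shows "\<bar>hadamard_prob m s / (\<Prod>i\<in>{1..<m}. row_prob i s) - 1\<bar> \<le> 220 * real m ^ 3 / s"
  using m
proof (induction m rule: nat_induct_at_least)
  case base
  then show ?case by (simp add: hadamard_prob_def card_hadamards_1[simplified])
next
  case (Suc k)
  define c where "c m = (\<Prod>i\<in>{1..<m}. row_prob i s)" for m
  define r where "r m = hadamard_prob m s / c m" for m
  have n3: "real n ^ 3 \<ge> 1" using n by (intro one_le_power) simp
  then have s0: "real s > 0" using s by linarith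
  then have s1: "s \<ge> 1" "t \<ge> 1" by (auto simp: s_def)
  have rp: "row_prob i s > 0" for i using s0 by (simp add: row_prob_def)
  have c: "c m > 0" for m using rp by (simp add: c_def prod_pos)
  have cS: "c (Suc k) = row_prob k s * c k"
    using Suc.hyps by (simp add: c_def prod.atLeastLessThan_Suc)
  have k: "k \<ge> 1" "k \<le> n" using Suc by auto
  have IH: "\<bar>r k - 1\<bar> \<le> 220 * real k ^ 3 / s" using Suc by (simp add: r_def c_def)
  have "real k ^ 3 \<le> real n ^ 3" using k by (intro power_mono) auto
  then have "440 * real k ^ 3 \<le> s" using s n3 by linarith
  then have "220 * real k ^ 3 / s \<le> 1 / 2" using s0 by (simp add: field_simps)
  with IH have r: "r k \<le> 3 / 2" by linarith
  define E where "E = 18 * (real k)\<^sup>2 / s + 2 * exp (- (s / (32 * k))) * sqrt 8 ^ k"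
  have E: "0 \<le> E" "E \<le> 146 * (real k)\<^sup>2 / s"
    using row_error_small[OF k s] by (simp_all add: E_def)
  have "\<bar>hadamard_prob (Suc k) s - row_prob k s * hadamard_prob k s\<bar> / c (Suc k)
      \<le> (row_prob k s * hadamard_prob k s * E + exp (- real s / 24)) / c (Suc k)"
    using hadamard_prob_Suc[OF k(1) s1(2)] c[of "Suc k"]
    by (intro divide_right_mono) (auto simp: E_def s_def)
  also have "\<bar>hadamard_prob (Suc k) s - row_prob k s * hadamard_prob k s\<bar> / c (Suc k)
      = \<bar>(hadamard_prob (Suc k) s - row_prob k s * hadamard_prob k s) / c (Suc k)\<bar>"
    using c[of "Suc k"] by (simp add: abs_divide)
  also have "(hadamard_prob (Suc k) s - row_prob k s * hadamard_prob k s) / c (Suc k) = r (Suc k) - r k"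
    using rp[of k] by (simp add: r_def cS diff_divide_distrib)
  also have "(row_prob k s * hadamard_prob k s * E + exp (- real s / 24)) / c (Suc k)
      = r k * E + exp (- real s / 24) / c (Suc k)"
    using rp[of k] by (simp add: r_def cS add_divide_distrib)
  finally have step: "\<bar>r (Suc k) - r k\<bar> \<le> r k * E + exp (- real s / 24) / c (Suc k)" .
  have "exp (- real s / 24) / c (Suc k) \<le> exp (- real s / 24) / (1 / sqrt (2 * pi * s)) ^ (n\<^sup>2)"
    using prod_row_prob_ge[OF s1(1) Suc.prems] s0
    by (intro divide_left_mono mult_pos_pos c) (auto simp: c_def)
  also have "\<dots> = exp (- real s / 24) * sqrt (2 * pi * s) ^ (n\<^sup>2)" by (simp add: power_divide)
  also have "\<dots> \<le> 1 / s" by (rule exceptional_term_small[OF n s])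
  finally have 1: "exp (- real s / 24) / c (Suc k) \<le> 1 / s" .
  have "r k * E \<le> 3 / 2 * (146 * (real k)\<^sup>2 / s)"
    using r E by (intro mult_mono) auto
  with step 1 have "\<bar>r (Suc k) - r k\<bar> \<le> 3 / 2 * (146 * (real k)\<^sup>2 / s) + 1 / s" by linarith
  also have "\<dots> = (219 * (real k)\<^sup>2 + 1) / s" by (simp add: add_divide_distrib)
  finally have "\<bar>r (Suc k) - r k\<bar> \<le> (219 * (real k)\<^sup>2 + 1) / s" .
  with IH have "\<bar>r (Suc k) - 1\<bar> \<le> 220 * real k ^ 3 / s + (219 * (real k)\<^sup>2 + 1) / s" by linarith
  also have "\<dots> = (220 * real k ^ 3 + 219 * (real k)\<^sup>2 + 1) / s" by (simp add: add_divide_distrib)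
  also have "\<dots> \<le> 220 * real (Suc k) ^ 3 / s"
    using s0 by (intro divide_right_mono) (auto simp: power3_eq_cube power2_eq_square algebra_simps)
  finally show ?case by (simp add: r_def c_def)
qed

theorem corollary4p1:
  shows "\<forall>\<epsilon>::real. \<epsilon> > 0 \<longrightarrow>
    (\<exists>K::real. K > 0 \<and>
      (\<forall>(n::nat) (t::nat). n \<ge> 2 \<longrightarrow> real t \<ge> K * real n ^ 3 \<longrightarrow>
        \<bar>real (num_partial_hadamard n (4 * t)) / hadamard_asymp n (4 * t) - 1\<bar> < \<epsilon>))"
proof (intro allI impI)
  fix \<epsilon> :: real assume e: "\<epsilon> > 0"
  \<comment> \<open>With \<open>s = 4t\<close>, 1000 provides \<open>s \<ge> 4000 n\<^sup>3\<close>, and 56 exceeds a quarter of the constant 220 in the error bound.\<close>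
  define K where "K = 1000 + 56 / \<epsilon>"
  have K: "K \<ge> 1000" "K * \<epsilon> > 55" using e by (auto simp: K_def field_simps add_pos_pos)
  show "\<exists>K::real. K > 0 \<and>
      (\<forall>(n::nat) (t::nat). n \<ge> 2 \<longrightarrow> real t \<ge> K * real n ^ 3 \<longrightarrow>
        \<bar>real (num_partial_hadamard n (4 * t)) / hadamard_asymp n (4 * t) - 1\<bar> < \<epsilon>)"
  proof (intro exI[of _ K] conjI allI impI)
    show "K > 0" using K by simp
    fix n t :: nat assume n: "n \<ge> 2" and t: "real t \<ge> K * real n ^ 3"
    have n3: "real n ^ 3 > 0" using n by simp
    have "1000 * real n ^ 3 \<le> K * real n ^ 3" using K n3 by (intro mult_right_mono) auto
    with t have t': "1000 * real n ^ 3 \<le> real t" by linarith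
    then have s: "4000 * real n ^ 3 \<le> real (4 * t)" by simp
    have t0: "real t > 0" using t' n3 by linarith
    have "real (num_partial_hadamard n (4 * t)) / hadamard_asymp n (4 * t)
        = hadamard_prob n (4 * t) / (\<Prod>i\<in>{1..<n}. row_prob i (4 * t))"
      using n t0 by (subst hadamard_asymp_eq_prod) (auto simp: num_partial_hadamard_eq hadamard_prob_def)
    then have "\<bar>real (num_partial_hadamard n (4 * t)) / hadamard_asymp n (4 * t) - 1\<bar>
        \<le> 220 * real n ^ 3 / real (4 * t)"
      using hadamard_prob_ratio[OF n s, of n] n by simp
    also have "\<dots> < \<epsilon>"
    proof -
      have "55 * real n ^ 3 < K * \<epsilon> * real n ^ 3" using K n3 by (intro mult_strict_right_mono)
      also have "\<dots> \<le> \<epsilon> * real t" using mult_left_mono[OF t, of \<epsilon>] e by (simp add: mult_ac)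
      finally show ?thesis using t0 by (simp add: field_simps)
    qed
    finally show "\<bar>real (num_partial_hadamard n (4 * t)) / hadamard_asymp n (4 * t) - 1\<bar> < \<epsilon>" .
  qed
qed

end
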